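(* Let $\alpha,\beta,k\ge 0$ be integers. For every integer $n\ge 0$, $$T_{3^{2\alpha+1}}\left(3^{2\alpha+2\beta+1}n+\frac{2\cdot 3^{2\alpha+2\beta+2}-3^{2\alpha+1}+1}{8}\right)\equiv 0\pmod{3^{3\alpha+2\beta+2}},$$ $$T_{3^{2\alpha+1}}\left(3^{2\alpha+2\beta+2}n+\frac{14\cdot 3^{2\alpha+2\beta+1}-3^{2\alpha+1}+1}{8}\right)\equiv 0\pmod{3^{3\alpha+2\beta+4}},$$ $$T_{3^{2\alpha+1}}\left(3^{2\alpha+2\beta+2}n+\frac{22\cdot 3^{2\alpha+2\beta+1}-3^{2\alpha+1}+1}{8}\right)\equiv 0\pmod{3^{3\alpha+2\beta+5}}.$$ Moreover, for every prime $p\equiv 3\pmod 4$ and every integer $n\ge 0$ with $p\nmid n$, $$T_{3^{2\alpha+1}}\left(3^{2\alpha+2\beta+2}p^{2k+1}n+\frac{2p^{2k+2}\cdot 3^{2\alpha+2\beta+2}-3^{2\alpha+1}+1}{8}\right)\equiv 0\pmod{3^{3\alpha+2\beta+4}}.$$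
   Context: $E(q^r)=\prod_{m\ge 1}(1-q^{rm})$. For a positive integer $\ell$, $T_\ell(n)$ is the number of $\ell$-regular partition triples of $n$ (no part divisible by $\ell$), defined by $\sum_{n\ge 0}T_\ell(n)q^n=\dfrac{E(q^\ell)^3}{E(q)^3}$. *)

theory Defs
  imports
    "HOL-Analysis.Analysis"
    "HOL-Computational_Algebra.Computational_Algebra"
    "HOL-Number_Theory.Number_Theory"
begin

text \<open>A partition is a multiset of positive integers; it is \<open>l\<close>-regular if \<open>l\<close> divides none of
  its parts.\<close>

definition regular_partition :: "nat \<Rightarrow> nat multiset \<Rightarrow> bool" where
  "regular_partition l M \<longleftrightarrow> (\<forall>p\<in>#M. 0 < p \<and> \<not> l dvd p)"

definition regular_partition_triples :: "nat \<Rightarrow> nat \<Rightarrow> (nat multiset \<times> nat multiset \<times> nat multiset) set" where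
  "regular_partition_triples l n =
     {(A, B, C). regular_partition l A \<and> regular_partition l B \<and> regular_partition l C
                 \<and> sum_mset A + sum_mset B + sum_mset C = n}"

definition T :: "nat \<Rightarrow> nat \<Rightarrow> nat" where
  "T l n = card (regular_partition_triples l n)"

text \<open>\<open>euler_fps r\<close> is \<open>E(q\<^sup>r)\<close>. The infinite product converges in the \<open>q\<close>-adic topology of
  formal power series (see \<open>euler_fps_has_prod\<close>), and \<open>T_generating_function\<close> shows that the
  counting function \<open>T\<close> has the generating function \<open>E(q\<^sup>l)\<^sup>3 / E(q)\<^sup>3\<close>.\<close>

definition euler_fps :: "nat \<Rightarrow> 'a::idom fps" where
  "euler_fps r = (\<Prod>m. 1 - fps_X ^ (r * Suc m))"

lemma fps_mult_nth_cong:
  fixes f g f' g' :: "'a::comm_semiring_1 fps"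
  assumes "\<And>i. i \<le> n \<Longrightarrow> fps_nth f i = fps_nth f' i" "\<And>i. i \<le> n \<Longrightarrow> fps_nth g i = fps_nth g' i"
  shows "fps_nth (f * g) n = fps_nth (f' * g') n"
  unfolding fps_mult_nth by (intro sum.cong) (auto simp: assms)

lemma euler_partial_stable:
  assumes "r > 0" "n \<le> N"
  shows "fps_nth (\<Prod>m\<le>N. 1 - fps_X ^ (r * Suc m) :: 'a::idom fps) n =
         fps_nth (\<Prod>m\<le>n. 1 - fps_X ^ (r * Suc m)) n"
  using assms(2)
proof (induction N rule: dec_induct)
  case base
  show ?case by simp
next
  case (step N)
  have "n < r * Suc (Suc N)"
    using step.hyps assms(1)
    by (metis One_nat_def Suc_leI le_imp_less_Suc le_less_trans less_SucI less_le_trans mult_le_mono1 nat_mult_1)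
  then show ?case
    using step.IH by (simp add: algebra_simps fps_X_power_mult_right_nth fps_X_power_mult_nth del: mult_Suc_right power_Suc)
qed

lemma euler_fps_has_prod:
  assumes "r > 0"
  shows "(\<lambda>m. 1 - fps_X ^ (r * Suc m) :: 'a::idom fps) has_prod (euler_fps r)"
    and "fps_nth (euler_fps r :: 'a fps) n = fps_nth (\<Prod>m\<le>n. 1 - fps_X ^ (r * Suc m)) n"
proof -
  define G :: "'a fps" where "G = Abs_fps (\<lambda>n. fps_nth (\<Prod>m\<le>n. 1 - fps_X ^ (r * Suc m)) n)"
  have "(\<lambda>N. \<Prod>m\<le>N. 1 - fps_X ^ (r * Suc m) :: 'a fps) \<longlonglongrightarrow> G"
  proof (rule tendsto_fpsI)
    fix n
    show "eventually (\<lambda>N. fps_nth (\<Prod>m\<le>N. 1 - fps_X ^ (r * Suc m) :: 'a fps) n = fps_nth G n) sequentially"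
      using eventually_ge_at_top[of n]
    proof eventually_elim
      case (elim N)
      then show ?case unfolding G_def fps_nth_Abs_fps by (rule euler_partial_stable[OF assms])
    qed
  qed
  moreover have "fps_nth G 0 = 1"
    using assms by (simp add: G_def fps_X_power_nth)
  hence "G \<noteq> 0" by auto
  ultimately have "(\<lambda>m. 1 - fps_X ^ (r * Suc m) :: 'a fps) has_prod G"
    by (simp add: has_prod_def raw_has_prod_def)
  moreover from this have "euler_fps r = G"
    unfolding euler_fps_def using has_prod_unique by metis
  ultimately show "(\<lambda>m. 1 - fps_X ^ (r * Suc m) :: 'a fps) has_prod (euler_fps r)"
    and "fps_nth (euler_fps r :: 'a fps) n = fps_nth (\<Prod>m\<le>n. 1 - fps_X ^ (r * Suc m)) n"
    by (simp_all add: G_def)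
qed

definition partitions_in :: "nat set \<Rightarrow> nat \<Rightarrow> nat multiset set" where
  "partitions_in S n = {M. set_mset M \<subseteq> S \<and> sum_mset M = n}"

definition partitions_in_fps :: "nat set \<Rightarrow> 'a::idom fps" where
  "partitions_in_fps S = Abs_fps (\<lambda>n. of_nat (card (partitions_in S n)))"

lemma size_le_sum_mset:
  assumes "\<forall>p\<in>#M. 0 < (p::nat)"
  shows "size M \<le> sum_mset M"
  using assms by (induction M) auto

lemma elem_le_sum_mset:
  assumes "(p::nat) \<in># M"
  shows "p \<le> sum_mset M"
  using assms by (metis le_add1 multi_member_split sum_mset.add_mset)

lemma finite_partitions_in:
  assumes "0 \<notin> S"
  shows "finite (partitions_in S n)"
proof (rule finite_subset)
  show "partitions_in S n \<subseteq> mset ` {xs. set xs \<subseteq> {..n} \<and> length xs \<le> n}"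
  proof
    fix M assume "M \<in> partitions_in S n"
    hence M: "set_mset M \<subseteq> S" "sum_mset M = n" by (auto simp: partitions_in_def)
    obtain xs where xs: "mset xs = M" using ex_mset by blast
    have "\<forall>p\<in>#M. 0 < p" using M assms by (metis gr0I subsetD)
    hence "length xs \<le> n" using size_le_sum_mset M xs by (metis size_mset)
    moreover have "set xs \<subseteq> {..n}" using elem_le_sum_mset M xs by auto
    ultimately show "M \<in> mset ` {xs. set xs \<subseteq> {..n} \<and> length xs \<le> n}" using xs by blast
  qed
  show "finite (mset ` {xs. set xs \<subseteq> {..n} \<and> length xs \<le> n})"
    by (intro finite_imageI finite_lists_length_le) auto
qed

lemma partitions_in_insert:
  assumes "0 \<notin> S" "0 < s" "s \<notin> S"
  shows "card (partitions_in (insert s S) n) =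
         card (partitions_in S n) + (if n < s then 0 else card (partitions_in (insert s S) (n - s)))"
proof -
  have split: "partitions_in (insert s S) n =
     partitions_in S n \<union> {M \<in> partitions_in (insert s S) n. s \<in># M}"
    by (auto simp: partitions_in_def)
  have disj: "partitions_in S n \<inter> {M \<in> partitions_in (insert s S) n. s \<in># M} = {}"
    using assms by (auto simp: partitions_in_def)
  have fin: "finite (partitions_in (insert s S) n)" "finite (partitions_in S n)"
    using assms by (auto intro!: finite_partitions_in)
  have "card (partitions_in (insert s S) n) =
        card (partitions_in S n) + card {M \<in> partitions_in (insert s S) n. s \<in># M}"
    by (subst split, rule card_Un_disjoint) (use fin disj in auto)
  moreover have "card {M \<in> partitions_in (insert s S) n. s \<in># M} =
        (if n < s then 0 else card (partitions_in (insert s S) (n - s)))"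
  proof (cases "n < s")
    case True
    hence "{M \<in> partitions_in (insert s S) n. s \<in># M} = {}"
      using elem_le_sum_mset by (fastforce simp: partitions_in_def)
    then have "card {M \<in> partitions_in (insert s S) n. s \<in># M} = 0" by (simp only: card.empty)
    then show ?thesis using True by simp
  next
    case False
    have "{M \<in> partitions_in (insert s S) n. s \<in># M} = add_mset s ` partitions_in (insert s S) (n - s)"
    proof (intro equalityI subsetI)
      fix M assume "M \<in> {M \<in> partitions_in (insert s S) n. s \<in># M}"
      then obtain M' where "M = add_mset s M'" "M \<in> partitions_in (insert s S) n"
        by (auto dest: multi_member_split)
      then show "M \<in> add_mset s ` partitions_in (insert s S) (n - s)"
        by (auto simp: partitions_in_def)
    next
      fix M assume "M \<in> add_mset s ` partitions_in (insert s S) (n - s)"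
      then show "M \<in> {M \<in> partitions_in (insert s S) n. s \<in># M}"
        using False by (auto simp: partitions_in_def)
    qed
    moreover have "inj_on (add_mset s) A" for A by (auto simp: inj_on_def)
    ultimately show ?thesis using False by (simp add: card_image)
  qed
  ultimately show ?thesis by simp
qed

lemma partitions_in_fps_finite:
  assumes "finite S" "0 \<notin> S"
  shows "(partitions_in_fps S :: 'a::idom fps) * (\<Prod>s\<in>S. 1 - fps_X ^ s) = 1"
  using assms
proof (induction S rule: finite_induct)
  case empty
  have "partitions_in {} n = (if n = 0 then {{#}} else {})" for n
    by (auto simp: partitions_in_def)
  then show ?case by (simp add: partitions_in_fps_def fps_eq_iff)
next
  case (insert s S)
  have "(partitions_in_fps (insert s S) :: 'a fps) = partitions_in_fps S + fps_X ^ s * partitions_in_fps (insert s S)"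
    using insert.prems insert.hyps
    by (intro fps_ext) (simp add: partitions_in_fps_def fps_X_power_mult_nth partitions_in_insert[of S s])
  hence "(partitions_in_fps (insert s S) :: 'a fps) * (1 - fps_X ^ s) = partitions_in_fps S"
    by (simp add: algebra_simps)
  then show ?case using insert by (simp add: mult.assoc[symmetric])
qed

lemma regular_partitions_fps:
  assumes "l > 0"
  shows "(partitions_in_fps {p. 0 < p \<and> \<not> l dvd p} :: 'a::idom fps) * euler_fps 1 = euler_fps l"
proof (rule fps_ext)
  fix n
  define N where "N = l * Suc n"
  define S where "S = {p. 0 < p \<and> \<not> l dvd p \<and> p \<le> N}"
  have nN: "n \<le> N" using assms unfolding N_def
    by (cases l) auto
  have "partitions_in S i = partitions_in {p. 0 < p \<and> \<not> l dvd p} i" if "i \<le> n" for i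
    using that nN elem_le_sum_mset unfolding partitions_in_def S_def
    by (auto simp: subset_iff) (meson order_trans)
  hence P: "fps_nth (partitions_in_fps {p. 0 < p \<and> \<not> l dvd p} :: 'a fps) i = fps_nth (partitions_in_fps S) i"
    if "i \<le> n" for i
    using that by (simp add: partitions_in_fps_def)
  have E1: "fps_nth (euler_fps 1 :: 'a fps) i = fps_nth (\<Prod>s\<in>{1..N}. 1 - fps_X ^ s) i" if "i \<le> n" for i
  proof -
    have "N > 0" using assms by (simp add: N_def)
    hence "Suc ` {..N - 1} = {1..N}"
      by (simp add: atMost_atLeast0 image_Suc_atLeastAtMost)
    hence "{1..N} = Suc ` {..N - 1}" ..
    hence "(\<Prod>s\<in>{1..N}. 1 - fps_X ^ s :: 'a fps) = (\<Prod>m\<le>N - 1. 1 - fps_X ^ (1 * Suc m))"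
      by (simp add: prod.reindex)
    moreover have "i \<le> N - 1"
    proof -
      have "Suc n \<le> l * Suc n" using assms by (cases l) auto
      hence "Suc i \<le> N" using that unfolding N_def by (rule_tac order_trans[OF Suc_le_mono[THEN iffD2]])
      thus ?thesis by simp
    qed
    ultimately show ?thesis
      by (simp only: euler_fps_has_prod(2)[OF zero_less_one] euler_partial_stable[OF zero_less_one, of i "N - 1"])
  qed
  have fin: "finite S" by (rule finite_subset[of _ "{..N}"]) (auto simp: S_def)
  have split: "{1..N} = S \<union> (\<lambda>m. l * Suc m) ` {..n}"
  proof (intro equalityI subsetI)
    fix x assume x: "x \<in> {1..N}"
    show "x \<in> S \<union> (\<lambda>m. l * Suc m) ` {..n}"
    proof (cases "l dvd x")
      case True
      then obtain k where k: "x = l * k" by auto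
      with x assms have "0 < k" "k \<le> Suc n" by (auto simp: N_def intro: Nat.gr0I simp del: mult_Suc_right)
      then obtain m where "k = Suc m" "m \<le> n" by (cases k) auto
      with k show ?thesis by blast
    qed (use x in \<open>auto simp: S_def\<close>)
  next
    fix x assume "x \<in> S \<union> (\<lambda>m. l * Suc m) ` {..n}"
    thus "x \<in> {1..N}"
    proof
      assume "x \<in> (\<lambda>m. l * Suc m) ` {..n}"
      then obtain m where m: "x = l * Suc m" "m \<le> n" by auto
      have "0 < x" using m(1) assms by simp
      moreover have "x \<le> N" using m unfolding N_def by (simp only: mult_le_mono2 Suc_le_mono)
      ultimately show ?thesis by simp
    qed (auto simp: S_def)
  qed
  have "inj_on (\<lambda>m. l * Suc m) {..n}" using assms by (auto simp: inj_on_def)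
  hence prod: "(\<Prod>s\<in>{1..N}. 1 - fps_X ^ s :: 'a fps) =
        (\<Prod>s\<in>S. 1 - fps_X ^ s) * (\<Prod>m\<le>n. 1 - fps_X ^ (l * Suc m))"
    unfolding split by (subst prod.union_disjoint) (auto simp: S_def fin[unfolded S_def] prod.reindex)
  have "fps_nth ((partitions_in_fps {p. 0 < p \<and> \<not> l dvd p} :: 'a fps) * euler_fps 1) n =
        fps_nth (partitions_in_fps S * (\<Prod>s\<in>{1..N}. 1 - fps_X ^ s) :: 'a fps) n"
    by (rule fps_mult_nth_cong) (use P E1 in auto)
  also have "(partitions_in_fps S * (\<Prod>s\<in>{1..N}. 1 - fps_X ^ s) :: 'a fps) =
             (partitions_in_fps S * (\<Prod>s\<in>S. 1 - fps_X ^ s)) * (\<Prod>m\<le>n. 1 - fps_X ^ (l * Suc m))"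
    by (simp only: prod mult.assoc)
  also have "\<dots> = (\<Prod>m\<le>n. 1 - fps_X ^ (l * Suc m))"
    by (subst partitions_in_fps_finite) (use fin in \<open>auto simp: S_def\<close>)
  also have "fps_nth \<dots> n = fps_nth (euler_fps l :: 'a fps) n"
    by (rule euler_fps_has_prod(2)[OF assms, symmetric])
  finally show "fps_nth ((partitions_in_fps {p. 0 < p \<and> \<not> l dvd p} :: 'a fps) * euler_fps 1) n =
     fps_nth (euler_fps l :: 'a fps) n" .
qed

lemma T_eq_sum:
  fixes l n
  defines "P \<equiv> partitions_in {p. 0 < p \<and> \<not> l dvd p}"
  shows "T l n = (\<Sum>i=0..n. card (P i) * (\<Sum>j=0..n-i. card (P j) * card (P (n - i - j))))"
    and "finite (regular_partition_triples l n)"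
proof -
  have fin: "finite (P i)" for i unfolding P_def by (rule finite_partitions_in) auto
  define Q where "Q = (SIGMA i:{0..n}. SIGMA j:{0..n-i}. P i \<times> P j \<times> P (n - i - j))"
  have eq: "regular_partition_triples l n = (\<lambda>(i,j,t). t) ` Q"
  proof (intro equalityI subsetI)
    fix t assume "t \<in> regular_partition_triples l n"
    then obtain A B C where t: "t = (A, B, C)" and *: "regular_partition l A" "regular_partition l B"
      "regular_partition l C" "sum_mset A + sum_mset B + sum_mset C = n"
      by (auto simp: regular_partition_triples_def)
    have "(sum_mset A, sum_mset B, A, B, C) \<in> Q"
      using * by (auto simp: Q_def P_def partitions_in_def regular_partition_def)
    then show "t \<in> (\<lambda>(i,j,t). t) ` Q" unfolding t by force
  next
    fix t assume "t \<in> (\<lambda>(i,j,t). t) ` Q"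
    then show "t \<in> regular_partition_triples l n"
      by (auto simp: Q_def P_def partitions_in_def regular_partition_def regular_partition_triples_def)
  qed
  have inj: "inj_on (\<lambda>(i,j,t). t) Q"
    by (auto simp: inj_on_def Q_def P_def partitions_in_def)
  have "finite Q" unfolding Q_def using fin by auto
  then show "finite (regular_partition_triples l n)" unfolding eq by simp
  have "T l n = card Q" unfolding T_def eq by (rule card_image[OF inj])
  also have "\<dots> = (\<Sum>i=0..n. card (P i) * (\<Sum>j=0..n-i. card (P j) * card (P (n - i - j))))"
    unfolding Q_def using fin by (simp add: card_cartesian_product sum_distrib_left)
  finally show "T l n = (\<Sum>i=0..n. card (P i) * (\<Sum>j=0..n-i. card (P j) * card (P (n - i - j))))" .
qed

lemma T_fps_eq_power:
  "Abs_fps (\<lambda>n. of_nat (T l n)) = (partitions_in_fps {p. 0 < p \<and> \<not> l dvd p} :: 'a::idom fps) ^ 3"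
proof (rule fps_ext)
  fix n
  define P where "P = partitions_in {p. 0 < p \<and> \<not> l dvd p}"
  define F where "F = (partitions_in_fps {p. 0 < p \<and> \<not> l dvd p} :: 'a fps)"
  have F: "fps_nth F i = of_nat (card (P i))" for i
    by (simp add: F_def P_def partitions_in_fps_def)
  have "fps_nth (F ^ 3) n = fps_nth (F * (F * F)) n"
    by (simp only: power3_eq_cube mult.assoc)
  also have "\<dots> = of_nat (T l n)"
    unfolding fps_mult_nth F T_eq_sum(1) P_def[symmetric] by simp
  finally show "fps_nth (Abs_fps (\<lambda>n. of_nat (T l n))) n = fps_nth (F ^ 3) n"
    by simp
qed

lemma T_generating_function_mult:
  assumes "l > 0"
  shows "Abs_fps (\<lambda>n. of_nat (T l n)) * (euler_fps 1 :: 'a::idom fps) ^ 3 = euler_fps l ^ 3"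
  unfolding T_fps_eq_power
  by (simp only: power_mult_distrib[symmetric] regular_partitions_fps[OF assms])

theorem T_generating_function:
  assumes "l > 0"
  shows "Abs_fps (\<lambda>n. of_nat (T l n)) = (euler_fps l ^ 3 / euler_fps 1 ^ 3 :: 'a::field fps)"
proof -
  have "fps_nth (euler_fps 1 :: 'a fps) 0 \<noteq> 0"
    by (simp add: euler_fps_has_prod(2))
  hence "(euler_fps 1 :: 'a fps) ^ 3 \<noteq> 0" by auto
  thus ?thesis
    using T_generating_function_mult[OF assms, where 'a = 'a] by (metis nonzero_mult_div_cancel_right)
qed

text \<open>On natural numbers \<open>-\<close> truncates and \<open>div\<close> rounds. The following show that neither
  happens in the offsets \<open>(c - 3\<^sup>2\<^sup>\<alpha>\<^sup>+\<^sup>1 + 1) / 8\<close> of the arithmetic progressions.\<close>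

lemma offset_exactI:
  assumes "[c = 2] (mod 8)" "3 ^ (2*\<alpha>+1) \<le> (c::nat)" "real c = x"
  shows "real ((c - 3 ^ (2*\<alpha>+1) + 1) div 8) = (x - 3 ^ (2*\<alpha>+1) + 1) / 8"
proof -
  have "[3 * 9 ^ \<alpha> = 3 * 1 ^ \<alpha>] (mod (8::nat))"
    by (intro cong_mult cong_pow) (simp_all add: cong_def)
  hence a: "(3::nat) ^ (2*\<alpha>+1) mod 8 = 3"
    by (simp add: power_mult cong_def)
  obtain d where d: "c = 3 ^ (2*\<alpha>+1) + d" using assms(2) le_Suc_ex by blast
  have "8 dvd d + 1" if "(x + d) mod 8 = 2" "x mod 8 = 3" for x :: nat
    using that by presburger
  from this[OF _ a] have "8 dvd d + 1" using assms(1) unfolding d cong_def by simp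
  thus ?thesis by (simp add: d real_of_nat_div flip: assms(3))
qed

lemma offsets_exact:
  fixes \<alpha> \<beta> k p :: nat
  shows "real ((2 * 3 ^ (2*\<alpha>+2*\<beta>+2) - 3 ^ (2*\<alpha>+1) + 1) div 8)
           = (2 * 3 ^ (2*\<alpha>+2*\<beta>+2) - 3 ^ (2*\<alpha>+1) + 1) / 8"
    and "real ((14 * 3 ^ (2*\<alpha>+2*\<beta>+1) - 3 ^ (2*\<alpha>+1) + 1) div 8)
           = (14 * 3 ^ (2*\<alpha>+2*\<beta>+1) - 3 ^ (2*\<alpha>+1) + 1) / 8"
    and "real ((22 * 3 ^ (2*\<alpha>+2*\<beta>+1) - 3 ^ (2*\<alpha>+1) + 1) div 8)
           = (22 * 3 ^ (2*\<alpha>+2*\<beta>+1) - 3 ^ (2*\<alpha>+1) + 1) / 8"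
    and "odd p \<Longrightarrow> real ((2 * p ^ (2*k+2) * 3 ^ (2*\<alpha>+2*\<beta>+2) - 3 ^ (2*\<alpha>+1) + 1) div 8)
           = (2 * real p ^ (2*k+2) * 3 ^ (2*\<alpha>+2*\<beta>+2) - 3 ^ (2*\<alpha>+1) + 1) / 8"
proof -
  have sq: "[x ^ (2*j) = 1] (mod 8)" if "odd x" for x j :: nat
  proof -
    have "x mod 8 \<in> {1, 3, 5, 7}" using that by simp presburger
    hence "(x mod 8) ^ 2 mod 8 = 1" by auto
    hence "[x ^ 2 = 1] (mod 8)" by (simp add: cong_def power_mod)
    hence "[(x ^ 2) ^ j = 1 ^ j] (mod 8)" by (rule cong_pow)
    thus ?thesis by (simp add: power_mult)
  qed
  have e: "[(3::nat) ^ (2*\<alpha>+2*\<beta>+2) = 1] (mod 8)"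
    using sq[of 3 "\<alpha>+\<beta>+1"] by (simp add: algebra_simps)
  have o: "[(3::nat) ^ (2*\<alpha>+2*\<beta>+1) = 3] (mod 8)"
    using cong_mult[OF cong_refl[of 3 8] sq[of 3 "\<alpha>+\<beta>"]] by (simp add: algebra_simps)
  have le: "(3::nat) ^ (2*\<alpha>+1) \<le> 3 ^ (2*\<alpha>+2*\<beta>+1)" "(3::nat) ^ (2*\<alpha>+1) \<le> 3 ^ (2*\<alpha>+2*\<beta>+2)"
    by (rule power_increasing; simp)+
  have "[2 * 3 ^ (2*\<alpha>+2*\<beta>+2) = (2::nat)] (mod 8)"
    using cong_mult[OF cong_refl[of 2 8] e] by simp
  moreover have "3 ^ (2*\<alpha>+1) \<le> 2 * (3::nat) ^ (2*\<alpha>+2*\<beta>+2)"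
    using le(2) by linarith
  ultimately show "real ((2 * 3 ^ (2*\<alpha>+2*\<beta>+2) - 3 ^ (2*\<alpha>+1) + 1) div 8)
           = (2 * 3 ^ (2*\<alpha>+2*\<beta>+2) - 3 ^ (2*\<alpha>+1) + 1) / 8"
    by (rule offset_exactI) simp
  have "[14 * 3 ^ (2*\<alpha>+2*\<beta>+1) = (2::nat)] (mod 8)"
    using cong_mult[OF cong_refl[of 14 8] o] by (simp add: cong_def)
  moreover have "3 ^ (2*\<alpha>+1) \<le> 14 * (3::nat) ^ (2*\<alpha>+2*\<beta>+1)"
    using le(1) by linarith
  ultimately show "real ((14 * 3 ^ (2*\<alpha>+2*\<beta>+1) - 3 ^ (2*\<alpha>+1) + 1) div 8)
           = (14 * 3 ^ (2*\<alpha>+2*\<beta>+1) - 3 ^ (2*\<alpha>+1) + 1) / 8"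
    by (rule offset_exactI) simp
  have "[22 * 3 ^ (2*\<alpha>+2*\<beta>+1) = (2::nat)] (mod 8)"
    using cong_mult[OF cong_refl[of 22 8] o] by (simp add: cong_def)
  moreover have "3 ^ (2*\<alpha>+1) \<le> 22 * (3::nat) ^ (2*\<alpha>+2*\<beta>+1)"
    using le(1) by linarith
  ultimately show "real ((22 * 3 ^ (2*\<alpha>+2*\<beta>+1) - 3 ^ (2*\<alpha>+1) + 1) div 8)
           = (22 * 3 ^ (2*\<alpha>+2*\<beta>+1) - 3 ^ (2*\<alpha>+1) + 1) / 8"
    by (rule offset_exactI) simp
  assume p: "odd p"
  have c: "[2 * p ^ (2*k+2) * 3 ^ (2*\<alpha>+2*\<beta>+2) = 2] (mod 8)"
    using cong_mult[OF cong_mult[OF cong_refl[of 2 8] sq[OF p, of "k+1"]] e] by simp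
  have "1 * 3 ^ (2*\<alpha>+1) \<le> (2 * p ^ (2*k+2)) * 3 ^ (2*\<alpha>+2*\<beta>+2)"
    using odd_pos[OF p] le(2) by (intro mult_mono) (auto simp: Suc_le_eq)
  hence "3 ^ (2*\<alpha>+1) \<le> 2 * p ^ (2*k+2) * 3 ^ (2*\<alpha>+2*\<beta>+2)" by (simp only: mult_1)
  with c show "real ((2 * p ^ (2*k+2) * 3 ^ (2*\<alpha>+2*\<beta>+2) - 3 ^ (2*\<alpha>+1) + 1) div 8)
           = (2 * real p ^ (2*k+2) * 3 ^ (2*\<alpha>+2*\<beta>+2) - 3 ^ (2*\<alpha>+1) + 1) / 8"
    by (rule offset_exactI) simp
qed

end

theory Submission
  imports Defs
begin

text \<open>
  Put \<open>a = (\<eta>(3\<tau>)/\<eta>(\<tau>))\<^sup>3\<close>, a power series in \<open>x = q\<^sup>1\<^sup>/\<^sup>4\<close>, and \<open>b(x) = a(x\<^sup>3)\<close>. Jacobi's identity gives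
  \<open>E(q)\<^sup>3 = P(q\<^sup>3) - 3q E(q\<^sup>9)\<^sup>3\<close>; multiplying the conjugates under \<open>q \<mapsto> \<omega>q\<close> for the cube
  roots of unity \<open>\<omega>\<close> yields \<open>a\<^sup>3 = b + 9ab\<^sup>2 + 27a\<^sup>2b\<^sup>3\<close>. Hence the operator \<open>U\<close> that keeps every third
  coefficient maps polynomials in \<open>a\<close> to polynomials in \<open>a\<close>, by a linear recursion that makes its matrix
  3-adically small away from one extreme slope. The generating function of \<open>T\<close> for \<open>l = 3\<^sup>m\<close> is the
  product of \<open>a(x), a(x\<^sup>3), \<dots>, a(x\<^sup>l\<^sup>/\<^sup>3)\<close>, so applying \<open>U\<close> to it peels off one factor at a time
  (\<open>f \<mapsto> U(f a)\<close>) before plain powers of \<open>U\<close> take over; two steps gain \<open>3\<^sup>3\<close> in the first regime and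
  \<open>3\<^sup>2\<close> in the second. The result is an integer multiple of \<open>3\<^sup>Na\<^sup>3\<close>, up to higher powers of 3, and
  \<open>a\<^sup>3 \<equiv> b + 9ab\<^sup>2\<close> modulo 27 settles the first three families. After one more step the leading term is
  \<open>a \<equiv> q\<^sup>1\<^sup>/\<^sup>4 E(q)\<^sup>6\<close> modulo 9, which by Jacobi's identity
  is supported on the exponents \<open>n/4\<close> with \<open>2n\<close> a sum of two odd squares.
\<close>

section \<open>Congruence of power series and Jacobi's identity\<close>

text \<open>Congruence modulo \<open>fps_X ^ (d+1)\<close>. Identities between infinite products are
  proved at every such precision, where finite products suffice.\<close>

definition fps_eq_upto :: "nat \<Rightarrow> 'a::zero fps \<Rightarrow> 'a fps \<Rightarrow> bool" where
  "fps_eq_upto d f g \<longleftrightarrow> (\<forall>i\<le>d. fps_nth f i = fps_nth g i)"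

lemma fps_eq_upto_refl [simp]: "fps_eq_upto d f f"
  by (simp add: fps_eq_upto_def)

lemma fps_eq_upto_sym: "fps_eq_upto d f g \<Longrightarrow> fps_eq_upto d g f"
  by (simp add: fps_eq_upto_def)

lemma fps_eq_upto_trans [trans]: "fps_eq_upto d f g \<Longrightarrow> fps_eq_upto d g h \<Longrightarrow> fps_eq_upto d f h"
  by (simp add: fps_eq_upto_def)

lemma fps_eq_upto_mult:
  fixes f g f' g' :: "'a::comm_semiring_1 fps"
  shows "fps_eq_upto d f f' \<Longrightarrow> fps_eq_upto d g g' \<Longrightarrow> fps_eq_upto d (f * g) (f' * g')"
  unfolding fps_eq_upto_def by (blast intro: fps_mult_nth_cong order_trans)

lemma fps_eq_upto_power:
  fixes f f' :: "'a::comm_semiring_1 fps"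
  shows "fps_eq_upto d f f' \<Longrightarrow> fps_eq_upto d (f ^ k) (f' ^ k)"
  by (induction k) (auto intro: fps_eq_upto_mult)

lemma fps_eq_upto_sum:
  "(\<And>k. k \<in> S \<Longrightarrow> fps_eq_upto d (f k) (g k)) \<Longrightarrow> fps_eq_upto d (sum f S) (sum g S)"
  by (simp add: fps_eq_upto_def fps_sum_nth)

lemma fps_eqI_upto: "(\<And>d. fps_eq_upto d f g) \<Longrightarrow> f = g"
  by (auto simp: fps_eq_upto_def fps_eq_iff)

text \<open>As \<open>h\<close> has constant term 1, coefficient \<open>i\<close> of a product with
  \<open>h\<close> determines coefficient \<open>i\<close> of the other factor once the lower ones
  are known.\<close>

lemma fps_eq_upto_mult_cancel:
  fixes f g h :: "'a::comm_ring_1 fps"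
  assumes "fps_nth h 0 = 1" "fps_eq_upto d (f * h) (g * h)"
  shows "fps_eq_upto d f g"
proof -
  have "i \<le> d \<longrightarrow> fps_nth f i = fps_nth g i" for i
  proof (induction i rule: less_induct)
    case (less i)
    show ?case
    proof
      assume "i \<le> d"
      have last: "fps_nth (k * h) i = (\<Sum>j<i. fps_nth k j * fps_nth h (i - j)) + fps_nth k i" for k
        using assms(1) by (simp add: fps_mult_nth atLeast0AtMost lessThan_Suc_atMost [symmetric])
      have "(\<Sum>j<i. fps_nth f j * fps_nth h (i - j)) = (\<Sum>j<i. fps_nth g j * fps_nth h (i - j))"
        using less \<open>i \<le> d\<close> by (intro sum.cong) auto
      with last[of f] last[of g] assms(2) \<open>i \<le> d\<close> show "fps_nth f i = fps_nth g i"
        by (simp add: fps_eq_upto_def)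
    qed
  qed
  thus ?thesis by (simp add: fps_eq_upto_def)
qed

section \<open>Truncated Euler products and triangular numbers\<close>

definition euler_part :: "nat \<Rightarrow> nat \<Rightarrow> 'a::idom fps" where
  "euler_part r n = (\<Prod>m<n. 1 - fps_X ^ (r * Suc m))"

lemma euler_part_0 [simp]: "euler_part r 0 = 1"
  by (simp add: euler_part_def)

lemma euler_part_Suc: "euler_part r (Suc n) = euler_part r n * (1 - fps_X ^ (r * Suc n))"
  by (simp add: euler_part_def)

lemma euler_part_nth_0 [simp]:
  assumes "r > 0" shows "fps_nth (euler_part r n) 0 = 1"
  using assms by (induction n) (simp_all add: euler_part_Suc del: mult_Suc_right)

lemma euler_part_upto:
  assumes "r > 0" "d < n"
  shows "fps_eq_upto d (euler_part r n :: 'a::idom fps) (euler_fps r)"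
  unfolding fps_eq_upto_def
proof (intro allI impI)
  fix i assume "i \<le> d"
  obtain N where n: "n = Suc N" using assms by (cases n) auto
  show "fps_nth (euler_part r n :: 'a fps) i = fps_nth (euler_fps r) i"
    using euler_partial_stable[of r i N, where 'a='a] assms \<open>i \<le> d\<close> n
    by (simp add: euler_part_def euler_fps_has_prod(2) lessThan_Suc_atMost del: mult_Suc_right)
qed

lemma euler_part_upto_euler_part:
  assumes "r > 0" "d < n" "d < m"
  shows "fps_eq_upto d (euler_part r n :: 'a::idom fps) (euler_part r m)"
  using euler_part_upto[OF assms(1,2)] euler_part_upto[OF assms(1,3)]
  by (blast intro: fps_eq_upto_trans fps_eq_upto_sym)

lemma euler_fps_nth_0 [simp]: "r > 0 \<Longrightarrow> fps_nth (euler_fps r) 0 = 1"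
  using euler_part_upto[of r 0 1] by (simp add: fps_eq_upto_def)

lemma euler_fps_nonzero: "r > 0 \<Longrightarrow> euler_fps r \<noteq> 0"
  using euler_fps_nth_0[of r] by (metis fps_zero_nth zero_neq_one)

definition triangular :: "nat \<Rightarrow> nat" where "triangular k = (\<Sum>i\<le>k. i)"

lemma triangular_0 [simp]: "triangular 0 = 0"
  and triangular_Suc: "triangular (Suc k) = triangular k + Suc k"
  by (simp_all add: triangular_def)

lemma le_triangular: "k \<le> triangular k"
  by (induction k) (simp_all add: triangular_Suc)

lemma eight_triangular: "8 * triangular k + 1 = (2 * k + 1) ^ 2"
  by (induction k) (simp_all add: triangular_Suc power2_eq_square algebra_simps)

text \<open>\<open>jacobi_coeff n k\<close> is the coefficient of \<open>z\<^sup>-\<^sup>k\<close> in \<open>(z; q)\<^sub>n\<^sub>+\<^sub>1 (q/z; q)\<^sub>n\<close>. The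
  recursion multiplies this product by \<open>(1 - z q\<^sup>n\<^sup>+\<^sup>1)(1 - q\<^sup>n\<^sup>+\<^sup>1/z)\<close>; the case \<open>k = 0\<close> uses that the
  coefficients are antisymmetric under \<open>k \<mapsto> -1-k\<close>.\<close>

fun jacobi_coeff :: "nat \<Rightarrow> nat \<Rightarrow> 'a::idom fps" where
  "jacobi_coeff 0 k = (if k = 0 then 1 else 0)"
| "jacobi_coeff (Suc n) k = (1 + fps_X ^ (2*n+2)) * jacobi_coeff n k - fps_X ^ (n+1) *
     ((if k = 0 then - jacobi_coeff n 0 else jacobi_coeff n (k-1)) + jacobi_coeff n (k+1))"

lemma jacobi_coeff_eq_0: "n < k \<Longrightarrow> jacobi_coeff n k = 0"
  by (induction n arbitrary: k) auto

text \<open>With \<open>u = q^(n-k)\<close> and \<open>w = q^(n+k+1)\<close>, the three summands on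
  the left are what the indices \<open>k\<close>, \<open>k-1\<close> and \<open>k+1\<close>
  contribute to the recursion of \<open>jacobi_coeff\<close> over a common denominator.\<close>

lemma jacobi_coeff_closed_step:
  fixes q u w :: "'a::comm_ring_1"
  shows "(1 + q*u*w) * ((1 - q*u) * (1 - q*w)) + q*u * ((1 - w) * (1 - q*w)) + q*w * ((1 - u) * (1 - q*u))
    = (1 - q*u*w) * (1 - q*q*u*w)"
  by (simp add: algebra_simps)

text \<open>The finite Jacobi triple product: up to sign and a power of q, the coefficient is the
  Gaussian binomial of 2n+1 over n-k, written with its denominators cleared.\<close>

lemma jacobi_coeff_closed:
  "k \<le> n \<Longrightarrow> jacobi_coeff n k * (euler_part 1 (n-k) * euler_part 1 (n+k+1)) =
     ((-1) ^ k * fps_X ^ triangular k * euler_part 1 (2*n+1) :: 'a::idom fps)"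
proof (induction n arbitrary: k)
  case 0
  thus ?case by (simp add: euler_part_Suc)
next
  case (Suc n)
  let ?E = "euler_part 1 :: nat \<Rightarrow> 'a fps"
  let ?c = "jacobi_coeff :: nat \<Rightarrow> nat \<Rightarrow> 'a fps"
  have E: "?E (Suc m) = ?E m * (1 - fps_X ^ Suc m)" for m
    by (simp add: euler_part_Suc)
  have E2: "?E (2 * Suc n + 1) = ?E (2*n+1) * ((1 - fps_X ^ (2*n+2)) * (1 - fps_X ^ (2*n+3)))"
    using E[of "2*n+1"] E[of "2*n+2"] by (simp add: mult.assoc eval_nat_numeral)
  show ?case
  proof (cases "k \<le> n")
    case False
    hence k: "k = Suc n" using Suc.prems by simp
    have "?c (Suc n) k = - (fps_X ^ (n+1) * ?c n n)"
      by (simp add: k jacobi_coeff_eq_0)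
    moreover have "?c n n * ?E (2 * Suc n + 1) = (-1) ^ n * fps_X ^ triangular n * ?E (2 * Suc n + 1)"
    proof -
      have "?c n n * ?E (2*n+1) = (-1) ^ n * fps_X ^ triangular n * ?E (2*n+1)"
        using Suc.IH[of n] by (simp add: mult_2)
      thus ?thesis unfolding E2 by (simp only: mult.assoc [symmetric])
    qed
    moreover have "?E (Suc n - k) * ?E (Suc n + k + 1) = ?E (2 * Suc n + 1)"
      by (simp add: k mult_2)
    moreover have "(-1) ^ k * fps_X ^ triangular k = - (fps_X ^ (n+1) * ((-1) ^ n * fps_X ^ triangular n) :: 'a fps)"
      unfolding k triangular_Suc power_add by simp
    ultimately show ?thesis
      by (simp only: mult_minus_left mult.assoc)
  next
    case True
    define m where "m = n - k"
    have n: "n = m + k" using True by (simp add: m_def)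
    define q :: "'a fps" where "q = fps_X"
    define u w where "u = q ^ m" and "w = q ^ (n+k+1)"
    define S where "S = (-1) ^ k * fps_X ^ triangular k * ?E (2*n+1)"
    define D where "D = ?E (Suc n - k) * ?E (Suc n + k + 1)"
    have Em: "?E (Suc n - k) = ?E m * (1 - q*u)"
      using E[of m] by (simp add: n u_def q_def)
    have Ev: "?E (Suc n + k + 1) = ?E (n+k+1) * (1 - q*w)"
      using E[of "n+k+1"] by (simp add: w_def q_def)
    have quv: "fps_X ^ (2*n+2) = q*u*w"
    proof -
      have "2*n+2 = 1 + m + (n+k+1)" by (simp add: n)
      thus ?thesis unfolding u_def w_def q_def by (simp only: power_add power_one_right)
    qed
    have t0: "?c n k * D = S * ((1 - q*u) * (1 - q*w))"
    proof -
      have "?c n k * D = (?c n k * (?E (n - k) * ?E (n+k+1))) * ((1 - q*u) * (1 - q*w))"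
        unfolding D_def Em Ev m_def by (simp only: mult_ac)
      thus ?thesis using Suc.IH[OF True] by (simp only: S_def)
    qed
    have tm: "fps_X ^ (n+1) * (if k = 0 then - ?c n 0 else ?c n (k-1)) * D = - (S * (q*u * ((1 - w) * (1 - q*w))))"
    proof (cases k)
      \<comment> \<open>The neighbour of index -1 is \<open>- ?c n 0\<close> by antisymmetry; as
        \<open>w = q*u\<close> here, \<open>t0\<close> already has the required shape.\<close>
      case 0
      have "fps_X ^ (n+1) = q*u" "w = q*u" by (simp_all add: u_def w_def q_def n 0)
      thus ?thesis using t0 by (simp add: 0 mult.assoc)
    next
      case (Suc j)
      have "?c n j * (?E (n-j) * ?E (n+j+1)) = (-1) ^ j * fps_X ^ triangular j * ?E (2*n+1)"
        using Suc.IH[of j] True Suc by simp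
      moreover have "?E (n - j) = ?E (Suc n - k)" using True Suc by simp
      moreover have "?E (n + k + 1) = ?E (n + j + 1) * (1 - w)"
        using E[of "n+k"] by (simp add: w_def q_def Suc)
      ultimately have cD: "?c n j * D = (-1) ^ j * fps_X ^ triangular j * ?E (2*n+1) * ((1 - w) * (1 - q*w))"
        unfolding D_def Ev by (simp add: mult_ac)
      have X: "fps_X ^ (n+1) * fps_X ^ triangular j = fps_X ^ triangular k * (q*u)"
        by (simp add: Suc triangular_Suc n u_def q_def power_add mult_ac)
      have "fps_X ^ (n+1) * ?c n j * D
          = (fps_X ^ (n+1) * fps_X ^ triangular j) * ((-1) ^ j * ?E (2*n+1) * ((1 - w) * (1 - q*w)))"
        unfolding mult.assoc[of _ _ D] cD by (simp only: mult_ac)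
      also have "\<dots> = - (S * (q*u * ((1 - w) * (1 - q*w))))"
        unfolding X S_def by (simp add: Suc mult_ac)
      finally show ?thesis by (simp add: Suc)
    qed
    have tp: "fps_X ^ (n+1) * ?c n (k+1) * D = - (S * (q*w * ((1 - u) * (1 - q*u))))"
    proof (cases m)
      \<comment> \<open>Here \<open>k = n\<close>: the neighbour \<open>k+1\<close> is out of range,
        and the right side vanishes because \<open>u = 1\<close>.\<close>
      case 0
      thus ?thesis by (simp add: jacobi_coeff_eq_0 n u_def)
    next
      case (Suc j)
      have IH: "?c n (k+1) * (?E j * ?E (Suc n + k + 1)) = (-1) ^ (k+1) * fps_X ^ triangular (k+1) * ?E (2*n+1)"
        using Suc.IH[of "k+1"] n Suc by simp
      have Ej: "?E m = ?E j * (1 - u)" using E[of j] by (simp add: Suc u_def q_def)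
      have "?c n (k+1) * D = (?c n (k+1) * (?E j * ?E (Suc n + k + 1))) * ((1 - u) * (1 - q*u))"
        unfolding D_def Em Ej by (simp only: mult_ac)
      hence cD: "?c n (k+1) * D = (-1) ^ (k+1) * fps_X ^ triangular (k+1) * ?E (2*n+1) * ((1 - u) * (1 - q*u))"
        by (simp only: IH)
      have X: "fps_X ^ (n+1) * fps_X ^ triangular (k+1) = fps_X ^ triangular k * (q*w)"
        by (simp add: triangular_Suc w_def q_def power_add mult_ac)
      have "fps_X ^ (n+1) * ?c n (k+1) * D
          = (fps_X ^ (n+1) * fps_X ^ triangular (k+1)) * ((-1) ^ (k+1) * ?E (2*n+1) * ((1 - u) * (1 - q*u)))"
        unfolding mult.assoc[of _ _ D] cD by (simp only: mult_ac)
      also have "\<dots> = - (S * (q*w * ((1 - u) * (1 - q*u))))"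
        unfolding X S_def by (simp add: mult_ac)
      finally show ?thesis .
    qed
    have "?c (Suc n) k * D = (1 + q*u*w) * (?c n k * D)
        - (fps_X ^ (n+1) * (if k = 0 then - ?c n 0 else ?c n (k-1)) * D + fps_X ^ (n+1) * ?c n (k+1) * D)"
      unfolding jacobi_coeff.simps(2) quv by (simp only: algebra_simps)
    also have "\<dots> = S * ((1 + q*u*w) * ((1 - q*u) * (1 - q*w)) + q*u * ((1 - w) * (1 - q*w)) + q*w * ((1 - u) * (1 - q*u)))"
      unfolding t0 tm tp by (simp add: algebra_simps)
    also have "\<dots> = S * ((1 - q*u*w) * (1 - q*q*u*w))"
      by (simp only: jacobi_coeff_closed_step)
    also have "\<dots> = (-1) ^ k * fps_X ^ triangular k * ?E (2 * Suc n + 1)"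
    proof -
      have "fps_X ^ (2*n+3) = q*q*u*w"
        using quv by (simp add: eval_nat_numeral q_def mult_ac)
      thus ?thesis unfolding E2 quv S_def by (simp only: mult_ac)
    qed
    finally show ?thesis unfolding D_def by simp
  qed
qed


text \<open>This is minus the derivative at z = 1 of the product whose coefficients are
  \<open>jacobi_coeff n\<close>: its factor 1 - z vanishes there, and pairing k with -1-k gives the
  weight 2k+1. The induction multiplies by \<open>(1 - fps_X ^ (n+1)) ^ 2\<close> in each
  step.\<close>

lemma sum_jacobi_coeff:
  "(\<Sum>k\<le>n. of_nat (2*k+1) * jacobi_coeff n k) = (euler_part 1 n ^ 2 :: 'a::idom fps)"
proof (induction n)
  case 0
  thus ?case by simp
next
  case (Suc n)
  let ?c = "jacobi_coeff n :: nat \<Rightarrow> 'a fps"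
  \<comment> \<open>\<open>?c k\<close> is met from index \<open>k+1\<close> with weight 2k+3 and
    from index \<open>k-1\<close> with weight 2k-1, together twice 2k+1. For \<open>k = 0\<close>
    the reflected term supplies the weight -1. The weight is written
    \<open>of_nat (2*k+1) - 2\<close> since subtraction on naturals would truncate it there.\<close>
  have shift: "(\<Sum>k\<le>Suc n. of_nat (2*k+1) * ((if k = 0 then - ?c 0 else ?c (k-1)) + ?c (k+1)))
     = 2 * (\<Sum>k\<le>n. of_nat (2*k+1) * ?c k)"
  proof -
    have "(\<Sum>k\<le>Suc n. of_nat (2*k+1) * (if k = 0 then - ?c 0 else ?c (k-1)))
        = - ?c 0 + (\<Sum>k\<le>n. of_nat (2*k+3) * ?c k)"
      by (simp add: sum.atMost_Suc_shift algebra_simps del: sum.atMost_Suc)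
    moreover have "(\<Sum>k\<le>Suc n. of_nat (2*k+1) * ?c (k+1)) = ?c 0 + (\<Sum>k\<le>n. (of_nat (2*k+1) - 2) * ?c k)"
    proof -
      have "(\<Sum>k\<le>Suc (Suc n). (of_nat (2*k+1) - 2) * ?c k) = - ?c 0 + (\<Sum>k\<le>Suc n. of_nat (2*k+1) * ?c (k+1))"
        by (subst sum.atMost_Suc_shift) (simp add: algebra_simps)
      moreover have "(\<Sum>k\<le>Suc (Suc n). (of_nat (2*k+1) - 2) * ?c k) = (\<Sum>k\<le>n. (of_nat (2*k+1) - 2) * ?c k)"
        by (simp add: jacobi_coeff_eq_0)
      ultimately have "- ?c 0 + (\<Sum>k\<le>Suc n. of_nat (2*k+1) * ?c (k+1)) = (\<Sum>k\<le>n. (of_nat (2*k+1) - 2) * ?c k)"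
        by (simp only:)
      moreover have "R = a + S" if "- a + R = S" for a R S :: "'a fps"
        using that by auto
      ultimately show ?thesis by blast
    qed
    ultimately have "(\<Sum>k\<le>Suc n. of_nat (2*k+1) * ((if k = 0 then - ?c 0 else ?c (k-1)) + ?c (k+1)))
       = (\<Sum>k\<le>n. of_nat (2*k+3) * ?c k) + (\<Sum>k\<le>n. (of_nat (2*k+1) - 2) * ?c k)"
      by (simp only: distrib_left sum.distrib) simp
    also have "\<dots> = (\<Sum>k\<le>n. 2 * (of_nat (2*k+1) * ?c k))"
      unfolding sum.distrib [symmetric] by (intro sum.cong) (simp_all add: algebra_simps)
    finally show ?thesis by (simp only: sum_distrib_left)
  qed
  have "(\<Sum>k\<le>Suc n. of_nat (2*k+1) * jacobi_coeff (Suc n) k)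
     = (1 + fps_X ^ (2*n+2)) * (\<Sum>k\<le>Suc n. of_nat (2*k+1) * ?c k)
       - fps_X ^ (n+1) * (\<Sum>k\<le>Suc n. of_nat (2*k+1) * ((if k = 0 then - ?c 0 else ?c (k-1)) + ?c (k+1)))"
    unfolding jacobi_coeff.simps(2) sum_distrib_left sum_subtractf [symmetric]
    by (intro sum.cong refl) (simp only: algebra_simps)
  also have "(\<Sum>k\<le>Suc n. of_nat (2*k+1) * ?c k) = euler_part 1 n ^ 2"
    using Suc.IH by (simp add: jacobi_coeff_eq_0)
  also note shift
  also note Suc.IH
  also have "(1 + fps_X ^ (2*n+2)) * euler_part 1 n ^ 2 - fps_X ^ (n+1) * (2 * euler_part 1 n ^ 2)
      = (euler_part 1 n * (1 - fps_X ^ (n+1)) :: 'a fps) ^ 2"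
  proof -
    have "fps_X ^ (2*n+2) = (fps_X ^ (n+1) :: 'a fps) ^ 2"
    proof -
      have "2*n+2 = (n+1)*2" by simp
      thus ?thesis by (simp only: power_mult)
    qed
    thus ?thesis by (simp only:) (simp add: power2_eq_square algebra_simps)
  qed
  finally show ?case by (simp add: euler_part_Suc)
qed

lemma fps_eq_upto_X_power_0: "d < m \<Longrightarrow> fps_eq_upto d (f * fps_X ^ m * g) (0 :: 'a::comm_ring_1 fps)"
  by (simp add: fps_eq_upto_def mult.assoc mult.left_commute[of f] fps_X_power_mult_nth)

text \<open>If \<open>k \<le> d\<close>, then \<open>2 * d < n\<close> makes all Euler products in
  the closed form longer than \<open>d\<close>, so they agree to this precision and cancel. If
  \<open>k > d\<close>, both sides vanish because \<open>triangular k > d\<close>.\<close>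

lemma jacobi_coeff_upto:
  assumes "2 * d < n" "k \<le> n"
  shows "fps_eq_upto d (jacobi_coeff n k * euler_part 1 n) ((-1) ^ k * fps_X ^ triangular k :: 'a::idom fps)"
proof (cases "k \<le> d")
  case True
  let ?E = "euler_part 1 :: nat \<Rightarrow> 'a fps"
  have E: "fps_eq_upto d (?E n) (?E m)" if "m > d" for m
    using assms that by (intro euler_part_upto_euler_part) auto
  have "fps_eq_upto d (jacobi_coeff n k * (?E n * ?E n)) (jacobi_coeff n k * (?E (n-k) * ?E (n+k+1)))"
    using assms True by (intro fps_eq_upto_mult fps_eq_upto_refl E) auto
  also note jacobi_coeff_closed[OF assms(2)]
  also have "fps_eq_upto d ((-1) ^ k * fps_X ^ triangular k * ?E (2*n+1)) ((-1) ^ k * fps_X ^ triangular k * ?E n)"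
    using assms by (intro fps_eq_upto_mult fps_eq_upto_refl fps_eq_upto_sym[OF E]) auto
  finally have "fps_eq_upto d (jacobi_coeff n k * ?E n * ?E n) ((-1) ^ k * fps_X ^ triangular k * ?E n)"
    by (simp only: mult.assoc)
  thus ?thesis by (rule fps_eq_upto_mult_cancel[rotated]) simp
next
  case False
  let ?E = "euler_part 1 :: nat \<Rightarrow> 'a fps"
  have d: "d < triangular k" using False le_triangular[of k] by simp
  have "fps_eq_upto d (jacobi_coeff n k * (?E (n-k) * ?E (n+k+1))) (0 * (?E (n-k) * ?E (n+k+1)))"
    unfolding jacobi_coeff_closed[OF assms(2)] using fps_eq_upto_X_power_0[OF d] by simp
  hence "fps_eq_upto d (jacobi_coeff n k :: 'a fps) 0"
    by (rule fps_eq_upto_mult_cancel[rotated]) simp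
  hence "fps_eq_upto d (jacobi_coeff n k * ?E n) (0 * ?E n)"
    by (intro fps_eq_upto_mult) simp_all
  moreover have "fps_eq_upto d ((-1) ^ k * fps_X ^ triangular k :: 'a fps) 0"
    using fps_eq_upto_X_power_0[OF d, of "(-1) ^ k" 1] by simp
  ultimately show ?thesis by (simp add: fps_eq_upto_def)
qed

text \<open>The sum of (-1)^k (2k+1) q^(k(k+1)/2). Each fibre of \<open>triangular\<close> has at
  most one element, and an empty fibre yields the coefficient 0.\<close>

definition jacobi_fps :: "'a::idom fps" where
  "jacobi_fps = Abs_fps (\<lambda>m. \<Sum>k | triangular k = m. (-1) ^ k * of_nat (2*k+1))"

lemma strict_mono_triangular: "strict_mono triangular"
  by (rule strict_monoI_Suc) (simp add: triangular_Suc)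

lemma triangular_eq_iff [simp]: "triangular j = triangular k \<longleftrightarrow> j = k"
  by (rule strict_mono_eq[OF strict_mono_triangular])

lemma jacobi_fps_nth_triangular: "fps_nth jacobi_fps (triangular k) = (-1) ^ k * of_nat (2*k+1)"
  by (simp add: jacobi_fps_def)

lemma jacobi_fps_nth_eq_0: "m \<notin> range triangular \<Longrightarrow> fps_nth jacobi_fps m = 0"
  by (auto simp: jacobi_fps_def intro!: sum.neutral)

text \<open>In the truncated cube, two factors become the weighted sum of
  \<open>sum_jacobi_coeff\<close>, and the third turns each coefficient into a signed monomial by
  \<open>jacobi_coeff_upto\<close>.\<close>

theorem euler_fps_cube: "euler_fps 1 ^ 3 = (jacobi_fps :: 'a::idom fps)"
proof (rule fps_eqI_upto)
  fix d :: nat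
  define n where "n = 2 * d + 1"
  let ?E = "euler_part 1 n :: 'a fps"
  have "fps_eq_upto d (euler_fps 1 ^ 3) (?E ^ 3)"
    by (intro fps_eq_upto_power fps_eq_upto_sym[OF euler_part_upto]) (simp_all add: n_def)
  also have "?E ^ 3 = (\<Sum>k\<le>n. of_nat (2*k+1) * (jacobi_coeff n k * ?E))"
    unfolding power3_eq_cube power2_eq_square[symmetric] sum_jacobi_coeff[symmetric]
    by (simp only: sum_distrib_right mult.assoc)
  also have "fps_eq_upto d \<dots> (\<Sum>k\<le>n. of_nat (2*k+1) * ((-1) ^ k * fps_X ^ triangular k))"
    by (intro fps_eq_upto_sum fps_eq_upto_mult fps_eq_upto_refl jacobi_coeff_upto) (auto simp: n_def)
  also have "fps_eq_upto d \<dots> jacobi_fps"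
    unfolding fps_eq_upto_def
  proof (intro allI impI)
    fix i assume i: "i \<le> d"
    have "fps_nth (of_nat (2*k+1) * ((-1) ^ k * fps_X ^ triangular k) :: 'a fps) i
        = (if triangular k = i then (-1) ^ k * of_nat (2*k+1) else 0)" for k
    proof -
      have X: "(of_nat (2*k+1) * ((-1) ^ k * fps_X ^ triangular k) :: 'a fps)
          = fps_const ((-1) ^ k * of_nat (2*k+1)) * fps_X ^ triangular k"
        by (simp add: fps_of_nat[symmetric] fps_const_power[symmetric] fps_const_mult[symmetric] fps_const_neg[symmetric] mult_ac
                 del: fps_const_mult fps_const_power fps_const_neg of_nat_add of_nat_Suc)
      show ?thesis unfolding X fps_mult_left_const_nth fps_X_power_nth by simp
    qed
    hence "fps_nth (\<Sum>k\<le>n. of_nat (2*k+1) * ((-1) ^ k * fps_X ^ triangular k) :: 'a fps) i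
        = (\<Sum>k\<le>n. if triangular k = i then (-1) ^ k * of_nat (2*k+1) else 0)"
      by (simp only: fps_sum_nth)
    also have "\<dots> = (\<Sum>k | triangular k = i. (-1) ^ k * of_nat (2*k+1))"
    proof -
      have "k \<le> n" if "triangular k = i" for k
        using le_triangular[of k] that i by (simp add: n_def)
      hence "{k. triangular k = i} = {k\<in>{..n}. triangular k = i}" by auto
      thus ?thesis by (simp only: sum.inter_filter[OF finite_atMost])
    qed
    finally show "fps_nth (\<Sum>k\<le>n. of_nat (2*k+1) * ((-1) ^ k * fps_X ^ triangular k) :: 'a fps) i
       = fps_nth jacobi_fps i"
      by (simp add: jacobi_fps_def)
  qed
  finally show "fps_eq_upto d (euler_fps 1 ^ 3) (jacobi_fps :: 'a fps)" .
qed

section \<open>The modular equation of degree three\<close>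

lemma fps_eq_upto_compose:
  "fps_eq_upto d f g \<Longrightarrow> fps_eq_upto d (f oo h) (g oo h)"
  by (simp add: fps_eq_upto_def fps_compose_nth)

lemma fps_X_power_compose_X_power:
  "s > 0 \<Longrightarrow> fps_X ^ m oo fps_X ^ s = (fps_X ^ (m * s) :: 'a::idom fps)"
  by (subst fps_X_power_compose) (simp, simp only: power_mult[symmetric] mult.commute)

lemma fps_compose_X_power_assoc:
  "r > 0 \<Longrightarrow> s > 0 \<Longrightarrow> (f oo fps_X ^ r) oo fps_X ^ s = (f oo fps_X ^ (r * s) :: 'a::idom fps)"
  by (subst fps_compose_assoc [symmetric]) (simp_all add: fps_X_power_compose_X_power)

lemma euler_part_compose_X_power:
  assumes "s > 0"
  shows "euler_part r n oo fps_X ^ s = (euler_part (r * s) n :: 'a::idom fps)"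
proof -
  have "euler_part r n oo fps_X ^ s = (\<Prod>m<n. (1 - fps_X ^ (r * Suc m)) oo fps_X ^ s :: 'a fps)"
    unfolding euler_part_def using assms by (intro fps_compose_prod_distrib) simp
  also have "\<dots> = euler_part (r * s) n"
    unfolding euler_part_def
    by (intro prod.cong refl) (simp only: fps_compose_sub_distrib fps_compose_1 fps_X_power_compose_X_power[OF assms] mult_ac)
  finally show ?thesis .
qed

lemma euler_fps_compose_X_power:
  assumes "r > 0" "s > 0"
  shows "euler_fps r oo fps_X ^ s = (euler_fps (r * s) :: 'a::idom fps)"
proof (rule fps_eqI_upto)
  fix d :: nat
  have "fps_eq_upto d (euler_fps r oo fps_X ^ s) (euler_part r (Suc d) oo fps_X ^ s :: 'a fps)"
    using assms by (intro fps_eq_upto_compose fps_eq_upto_sym[OF euler_part_upto]) auto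
  also have "fps_eq_upto d \<dots> (euler_fps (r * s))"
    unfolding euler_part_compose_X_power[OF assms(2)] using assms by (intro euler_part_upto) auto
  finally show "fps_eq_upto d (euler_fps r oo fps_X ^ s) (euler_fps (r * s) :: 'a fps)" .
qed

lemma triangular_mod_3_neq_1: "k mod 3 \<noteq> 1 \<Longrightarrow> triangular k mod 3 = 0"
proof -
  have step: "triangular (3 * Suc j) = triangular (3*j) + 3 * (3*j+2)" for j
    by (simp add: triangular_Suc eval_nat_numeral)
  have "triangular (3*j) mod 3 = 0" for j
    by (induction j) (simp, simp only: step mod_mult_self2)
  moreover have "triangular (3*j+2) = triangular (3*j) + 3 * (2*j+1)" for j
    by (simp add: triangular_Suc eval_nat_numeral)
  ultimately have "\<forall>j. triangular (3*j) mod 3 = 0 \<and> triangular (3*j+2) mod 3 = 0"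
    by (simp only: mod_mult_self2) simp
  moreover assume "k mod 3 \<noteq> 1"
  hence "k = 3 * (k div 3) \<or> k = 3 * (k div 3) + 2" by presburger
  ultimately show ?thesis by metis
qed

lemma triangular_3_1: "triangular (3*j+1) = 9 * triangular j + 1"
  by (induction j) (simp_all add: triangular_Suc eval_nat_numeral)

text \<open>\<open>triangular k\<close> is prime to 3 only for \<open>k = 3*j+1\<close>. It is then
  \<open>9 * triangular j + 1\<close>, with coefficient -3 (-1)^j (2j+1), which the second summand
  cancels.\<close>

lemma jacobi_fps_trisection:
  assumes "n mod 3 \<noteq> 0"
  shows "fps_nth (jacobi_fps + 3 * fps_X * (jacobi_fps oo fps_X ^ 9) :: 'a::idom fps) n = 0"
proof -
  obtain m where n: "n = Suc m" using assms by (cases n) auto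
  have eq: "fps_nth (jacobi_fps + 3 * fps_X * (jacobi_fps oo fps_X ^ 9) :: 'a fps) n
      = fps_nth jacobi_fps n + 3 * (if 9 dvd m then fps_nth jacobi_fps (m div 9) else 0)"
    by (simp add: n mult.assoc fps_nth_compose_X_power fps_numeral_fps_const)
  show ?thesis
  proof (cases "\<exists>k. n = triangular k")
    case True
    then obtain k where k: "n = triangular k" by blast
    with assms have "k mod 3 = 1" using triangular_mod_3_neq_1 by metis
    then obtain j where j: "k = 3*j+1" by (metis mult_div_mod_eq)
    have m: "m = 9 * triangular j" using k n j triangular_3_1[of j] by simp
    have "odd k \<longleftrightarrow> even j" using j by auto
    thus ?thesis unfolding eq unfolding k m
      by (cases "even j") (simp_all add: jacobi_fps_nth_triangular j)
  next
    case False
    have "m div 9 \<notin> range triangular" if "9 dvd m"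
    proof
      assume "m div 9 \<in> range triangular"
      then obtain j where "m div 9 = triangular j" by blast
      hence "n = triangular (3*j+1)" using that n triangular_3_1[of j] by auto
      thus False using False by blast
    qed
    moreover have "n \<notin> range triangular" using False by blast
    ultimately show ?thesis unfolding eq by (simp add: jacobi_fps_nth_eq_0)
  qed
qed

section \<open>Cube roots of unity and the norm to series in q^3\<close>

definition omega :: complex where "omega = Complex (-1/2) (sqrt 3 / 2)"

lemma omega_eq: "omega ^ 2 = -1 - omega"
  by (simp add: omega_def complex_eq_iff power2_eq_square)

lemma omega_cube: "omega ^ 3 = 1"
proof -
  have "omega ^ 3 = omega * (-1 - omega)"
    unfolding omega_eq[symmetric] by (simp add: eval_nat_numeral)
  also have "\<dots> = - omega - omega ^ 2" by (simp add: algebra_simps power2_eq_square)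
  finally show ?thesis unfolding omega_eq by simp
qed

lemma omega_power_mod: "omega ^ n = omega ^ (n mod 3)"
proof -
  have "omega ^ n = omega ^ (3 * (n div 3) + n mod 3)" by simp
  thus ?thesis unfolding power_add power_mult omega_cube by simp
qed

definition rotate_fps :: "complex \<Rightarrow> complex fps \<Rightarrow> complex fps" where
  "rotate_fps w f = f oo (fps_const w * fps_X)"

lemma rotate_fps_nth [simp]: "fps_nth (rotate_fps w f) n = w ^ n * fps_nth f n"
  by (simp add: rotate_fps_def)

lemma rotate_fps_mult: "rotate_fps w (f * g) = rotate_fps w f * rotate_fps w g"
  by (simp add: rotate_fps_def fps_compose_mult_distrib)

lemma rotate_fps_power: "rotate_fps w (f ^ n) = rotate_fps w f ^ n"
  by (simp add: rotate_fps_def fps_compose_power)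

lemma rotate_fps_one_minus_X: "rotate_fps w (1 - fps_X ^ m) = 1 - fps_const (w ^ m) * fps_X ^ m"
  by (rule fps_ext) (simp add: fps_X_power_nth)

text \<open>The norm from Laurent series in q down to those in q^3, restricted to power
  series.\<close>

definition norm3_fps :: "complex fps \<Rightarrow> complex fps" where
  "norm3_fps f = f * rotate_fps omega f * rotate_fps (omega ^ 2) f"

lemma norm3_fps_mult: "norm3_fps (f * g) = norm3_fps f * norm3_fps g"
  by (simp add: norm3_fps_def rotate_fps_mult mult_ac)

lemma norm3_fps_power: "norm3_fps (f ^ n) = norm3_fps f ^ n"
  by (simp add: norm3_fps_def rotate_fps_power power_mult_distrib)

lemma norm3_factor:
  fixes P Y :: "complex fps"
  shows "(P - Y) * (P - fps_const omega * Y) * (P - fps_const (omega ^ 2) * Y) = P ^ 3 - Y ^ 3"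
proof -
  define c where "c = fps_const omega"
  have c2: "fps_const (omega ^ 2) = -1 - c"
    unfolding omega_eq c_def by (simp add: fps_const_sub[symmetric] fps_const_neg[symmetric] del: fps_const_sub fps_const_neg)
  have cc: "c * c = -1 - c"
    unfolding c2[symmetric] by (simp add: c_def power2_eq_square)
  have "(P - Y) * (P - c * Y) * (P - (-1 - c) * Y) = (P - Y) * (P*P + P*Y - (c + c*c) * (Y*Y))"
    by (simp add: algebra_simps)
  also have "\<dots> = P ^ 3 - Y ^ 3" unfolding cc by (simp add: algebra_simps power3_eq_cube)
  finally show ?thesis unfolding c2 by (simp only: c_def)
qed

text \<open>Rotation fixes q^m if 3 divides m; otherwise the conjugates run through all 1 - \<zeta>
  q^m with \<zeta>^3 = 1.\<close>

lemma norm3_fps_one_minus_X_power: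
  "norm3_fps (1 - fps_X ^ m) = (if 3 dvd m then (1 - fps_X ^ m) ^ 3 else 1 - fps_X ^ (3*m))"
proof -
  have *: "norm3_fps (1 - fps_X ^ m)
      = (1 - fps_X ^ m) * (1 - fps_const (omega ^ (m mod 3)) * fps_X ^ m) * (1 - fps_const (omega ^ ((2*m) mod 3)) * fps_X ^ m)"
    unfolding norm3_fps_def rotate_fps_one_minus_X power_mult[symmetric] by (simp only: omega_power_mod[symmetric])
  have X: "(1 - fps_X ^ m) * (1 - fps_const omega * fps_X ^ m) * (1 - fps_const (omega ^ 2) * fps_X ^ m) = 1 - fps_X ^ (3*m)"
    using norm3_factor[of 1 "fps_X ^ m"] by (simp add: power_mult[symmetric] mult.commute)
  consider "m mod 3 = 0" | "m mod 3 = 1" | "m mod 3 = 2" by linarith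
  thus ?thesis
  proof cases
    case 1
    hence "(2*m) mod 3 = 0" by presburger
    thus ?thesis using 1 unfolding * by (simp add: power3_eq_cube dvd_eq_mod_eq_0)
  next
    case 2
    hence "(2*m) mod 3 = 2" by presburger
    thus ?thesis using 2 X unfolding * by (simp add: dvd_eq_mod_eq_0)
  next
    case 3
    hence "(2*m) mod 3 = 1" by presburger
    thus ?thesis using 3 X unfolding * by (simp add: dvd_eq_mod_eq_0 mult_ac)
  qed
qed

text \<open>Three factors are added at a time. Exponents 3n+1 and 3n+2 give factors of
  \<open>euler_part 3 (3*n)\<close>, exponent 3n+3 gives a cube from \<open>euler_part 3 n\<close>,
  and \<open>euler_part 9 n\<close> supplies the factors still missing.\<close>

lemma norm3_euler_part:
  "euler_part 9 n * norm3_fps (euler_part 1 (3*n)) = euler_part 3 (3*n) * euler_part 3 n ^ 3"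
proof (induction n)
  case 0
  show ?case by (simp add: norm3_fps_def rotate_fps_def)
next
  case (Suc n)
  have three: "euler_part r (3 * Suc n) = euler_part r (3*n) *
      ((1 - fps_X ^ (r * (3*n+1))) * (1 - fps_X ^ (r * (3*n+2))) * (1 - fps_X ^ (r * (3*n+3))) :: complex fps)" for r
    using euler_part_Suc[of r "3*n", where 'a=complex] euler_part_Suc[of r "3*n+1", where 'a=complex]
      euler_part_Suc[of r "3*n+2", where 'a=complex]
    by (simp add: numeral_3_eq_3 mult.assoc del: mult_Suc_right)
  have nd: "\<not> 3 dvd 3*n+1" "\<not> 3 dvd 3*n+2" "3 dvd 3*n+3" by presburger+
  define a b c where "a = (1 - fps_X ^ (3 * (3*n+1)) :: complex fps)"
    and "b = (1 - fps_X ^ (3 * (3*n+2)) :: complex fps)" and "c = (1 - fps_X ^ (3*n+3) :: complex fps)"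
  have N: "norm3_fps (euler_part 1 (3 * Suc n)) = norm3_fps (euler_part 1 (3*n)) * (a * b * c ^ 3)"
    unfolding three norm3_fps_mult norm3_fps_one_minus_X_power mult_1 if_not_P[OF nd(1)] if_not_P[OF nd(2)] if_P[OF nd(3)]
    by (simp only: a_def b_def c_def)
  define d where "d = (1 - fps_X ^ (3 * (3*n+3)) :: complex fps)"
  have "euler_part 9 (Suc n) = euler_part 9 n * d"
    unfolding euler_part_Suc d_def by (simp add: algebra_simps)
  hence "euler_part 9 (Suc n) * norm3_fps (euler_part 1 (3 * Suc n))
      = (euler_part 9 n * norm3_fps (euler_part 1 (3*n))) * (d * (a * b * c ^ 3))"
    unfolding N by (simp only: mult_ac)
  also have "\<dots> = (euler_part 3 (3*n) * (a * b * d)) * (euler_part 3 n * c) ^ 3"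
    unfolding Suc.IH by (simp only: power_mult_distrib mult_ac)
  also have "euler_part 3 (3*n) * (a * b * d) = euler_part 3 (3 * Suc n)"
    unfolding three by (simp only: a_def b_def d_def)
  also have "euler_part 3 n * c = euler_part 3 (Suc n)"
    unfolding euler_part_Suc c_def by (simp add: algebra_simps)
  finally show ?case .
qed

lemma norm3_euler_fps: "euler_fps 9 * norm3_fps (euler_fps 1) = euler_fps 3 ^ 4"
proof (rule fps_eqI_upto)
  fix d :: nat
  define n where "n = Suc d"
  have E: "fps_eq_upto d (euler_part r m) (euler_fps r :: complex fps)" if "r > 0" "n \<le> m" for r m
    using that by (intro euler_part_upto) (auto simp: n_def)
  have "fps_eq_upto d (euler_fps 9 * norm3_fps (euler_fps 1)) (euler_part 9 n * norm3_fps (euler_part 1 (3*n)))"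
    unfolding norm3_fps_def rotate_fps_def
    by (intro fps_eq_upto_mult fps_eq_upto_compose fps_eq_upto_sym[OF E]) auto
  also note norm3_euler_part
  also have "fps_eq_upto d (euler_part 3 (3*n) * euler_part 3 n ^ 3) (euler_fps 3 * euler_fps 3 ^ 3 :: complex fps)"
    by (intro fps_eq_upto_mult fps_eq_upto_power E) auto
  also have "euler_fps 3 * euler_fps 3 ^ 3 = (euler_fps 3 ^ 4 :: complex fps)"
    by (simp add: eval_nat_numeral)
  finally show "fps_eq_upto d (euler_fps 9 * norm3_fps (euler_fps 1)) (euler_fps 3 ^ 4)" .
qed

text \<open>Write the cube of E(q) as P - Y with P in exponents 0 and Y in exponents 1 modulo 3. Its
  norm is P^3 - Y^3, and by multiplicativity also the cube of the norm of E(q).\<close>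

lemma euler_cubic_complex:
  "euler_fps 9 ^ 3 * ((euler_fps 1 ^ 3 + 3 * fps_X * euler_fps 9 ^ 3) ^ 3 - (3 * fps_X * euler_fps 9 ^ 3) ^ 3)
    = (euler_fps 3 ^ 12 :: complex fps)"
proof -
  define Y P :: "complex fps" where "Y = 3 * fps_X * euler_fps 9 ^ 3" and "P = euler_fps 1 ^ 3 + Y"
  have E9: "euler_fps 9 ^ 3 = (euler_fps 1 ^ 3 :: complex fps) oo fps_X ^ 9"
    by (subst fps_compose_power [symmetric]) (simp_all add: euler_fps_compose_X_power del: One_nat_def)
  have P: "fps_nth P n = 0" if "n mod 3 \<noteq> 0" for n
    using jacobi_fps_trisection[OF that, where 'a=complex] unfolding P_def Y_def E9 euler_fps_cube .
  have Y: "fps_nth Y n = 0" if "n mod 3 \<noteq> 1" for n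
  proof (cases n)
    case 0
    thus ?thesis by (simp add: Y_def)
  next
    case (Suc m)
    hence "\<not> 9 dvd m" using that by presburger
    thus ?thesis unfolding Y_def E9
      by (simp add: Suc mult.assoc fps_numeral_fps_const fps_nth_compose_X_power)
  qed
  have rot: "rotate_fps w (P - Y) = P - fps_const w * Y" if w: "w ^ 3 = 1" for w
  proof (rule fps_ext)
    fix n
    have wn: "w ^ n = w ^ (n mod 3)"
    proof -
      have "w ^ n = w ^ (3 * (n div 3) + n mod 3)" by simp
      thus ?thesis unfolding power_add power_mult w by simp
    qed
    show "fps_nth (rotate_fps w (P - Y)) n = fps_nth (P - fps_const w * Y) n"
      using P[of n] Y[of n] wn by (cases "n mod 3 = 0"; cases "n mod 3 = 1") (auto simp: algebra_simps)
  qed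
  have "(omega ^ 2) ^ 3 = 1" using omega_cube by (metis power_mult mult.commute power_one)
  hence "norm3_fps (P - Y) = P ^ 3 - Y ^ 3"
    unfolding norm3_fps_def using norm3_factor by (simp add: rot omega_cube)
  moreover have "P - Y = euler_fps 1 ^ 3" by (simp add: P_def)
  ultimately have "euler_fps 9 ^ 3 * (P ^ 3 - Y ^ 3) = (euler_fps 9 * norm3_fps (euler_fps 1)) ^ 3"
    by (simp add: norm3_fps_power power_mult_distrib)
  also have "\<dots> = euler_fps 3 ^ 12" unfolding norm3_euler_fps by (simp add: power_mult[symmetric])
  finally show ?thesis unfolding P_def Y_def .
qed

text \<open>The coefficientwise embedding is an injective ring homomorphism, so identities found
  with complex cube roots of unity descend to integer series.\<close>

definition complex_fps :: "int fps \<Rightarrow> complex fps" where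
  "complex_fps f = Abs_fps (\<lambda>n. of_int (fps_nth f n))"

lemma complex_fps_nth [simp]: "fps_nth (complex_fps f) n = of_int (fps_nth f n)"
  by (simp add: complex_fps_def)

lemma complex_fps_inject: "complex_fps f = complex_fps g \<longleftrightarrow> f = g"
  by (simp add: fps_eq_iff)

lemma complex_fps_hom:
  "complex_fps (f + g) = complex_fps f + complex_fps g"
  "complex_fps (f - g) = complex_fps f - complex_fps g"
  "complex_fps (f * g) = complex_fps f * complex_fps g"
  "complex_fps 1 = 1" "complex_fps (numeral k) = numeral k" "complex_fps fps_X = fps_X"
  by (rule fps_ext; simp add: fps_mult_nth fps_numeral_nth fps_X_nth)+

lemma complex_fps_power: "complex_fps (f ^ n) = complex_fps f ^ n"
  by (induction n) (simp_all add: complex_fps_hom)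

lemma euler_fps_nth: "r > 0 \<Longrightarrow> fps_nth (euler_fps r) n = fps_nth (euler_part r (Suc n)) n"
  using euler_part_upto[of r n "Suc n"] unfolding fps_eq_upto_def by (metis lessI order_refl)

lemma complex_fps_euler:
  assumes "r > 0"
  shows "complex_fps (euler_fps r) = euler_fps r"
proof -
  have "complex_fps (euler_part r n) = euler_part r n" for n
    by (induction n) (simp_all add: euler_part_Suc complex_fps_hom complex_fps_power del: mult_Suc_right)
  thus ?thesis by (intro fps_ext) (metis complex_fps_nth euler_fps_nth[OF assms])
qed

theorem euler_cubic:
  "euler_fps 9 ^ 3 * (euler_fps 1 ^ 9 + 9 * fps_X * euler_fps 1 ^ 6 * euler_fps 9 ^ 3
     + 27 * fps_X ^ 2 * euler_fps 1 ^ 3 * euler_fps 9 ^ 6) = (euler_fps 3 ^ 12 :: int fps)"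
proof -
  have "euler_fps 9 ^ 3 * ((euler_fps 1 ^ 3 + 3 * fps_X * euler_fps 9 ^ 3) ^ 3 - (3 * fps_X * euler_fps 9 ^ 3) ^ 3)
      = (euler_fps 3 ^ 12 :: int fps)"
    unfolding complex_fps_inject[symmetric]
    by (simp only: complex_fps_hom complex_fps_power complex_fps_euler zero_less_numeral zero_less_one euler_cubic_complex)
  moreover have "(x + 3 * z * y) ^ 3 - (3 * z * y) ^ 3 = x ^ 3 + 9 * z * x ^ 2 * y + 27 * z ^ 2 * x * y ^ 2"
    for x y z :: "int fps"
    by (simp add: power3_eq_cube power2_eq_square algebra_simps)
  ultimately show ?thesis by (simp add: power_mult[symmetric])
qed

section \<open>Generating functions and the operator \<open>U\<^sub>3\<close>\<close>

definition T_fps :: "nat \<Rightarrow> int fps" where "T_fps l = Abs_fps (\<lambda>n. int (T l n))"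

lemma T_fps_mult: "l > 0 \<Longrightarrow> T_fps l * euler_fps 1 ^ 3 = euler_fps l ^ 3"
  unfolding T_fps_def by (rule T_generating_function_mult)

lemma T_fps_eqI:
  assumes "l > 0" "f * euler_fps 1 ^ 3 = euler_fps l ^ 3"
  shows "T_fps l = f"
  using T_fps_mult[OF assms(1)] assms(2) euler_fps_nonzero[of 1, where 'a=int] by (metis mult_right_cancel power_not_zero zero_less_one)

lemma T_fps_1: "T_fps 1 = 1"
  by (rule T_fps_eqI) simp_all

lemma euler_fps_power_compose:
  "r > 0 \<Longrightarrow> s > 0 \<Longrightarrow> euler_fps r ^ n oo fps_X ^ s = (euler_fps (r * s) ^ n :: 'a::idom fps)"
  by (subst fps_compose_power [symmetric]) (simp_all add: euler_fps_compose_X_power)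

lemma T_fps_mult_compose:
  assumes "l > 0" "s > 0"
  shows "(T_fps l oo fps_X ^ s) * euler_fps s ^ 3 = euler_fps (l * s) ^ 3"
proof -
  have "(T_fps l * euler_fps 1 ^ 3) oo fps_X ^ s = (T_fps l oo fps_X ^ s) * euler_fps s ^ 3"
    using assms by (subst fps_compose_mult_distrib) (simp_all add: euler_fps_power_compose del: One_nat_def)
  thus ?thesis using assms by (simp add: T_fps_mult euler_fps_power_compose del: One_nat_def)
qed

text \<open>The quotient of cubed Euler products telescopes through
  \<open>euler_fps s\<close>.\<close>

lemma T_fps_mult_index:
  assumes "l > 0" "s > 0"
  shows "T_fps (l * s) = T_fps s * (T_fps l oo fps_X ^ s)"
proof (rule T_fps_eqI)
  have "T_fps s * (T_fps l oo fps_X ^ s) * euler_fps 1 ^ 3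
      = (T_fps l oo fps_X ^ s) * (T_fps s * euler_fps 1 ^ 3)" by (simp only: mult_ac)
  thus "T_fps s * (T_fps l oo fps_X ^ s) * euler_fps 1 ^ 3 = euler_fps (l * s) ^ 3"
    unfolding T_fps_mult[OF assms(2)] T_fps_mult_compose[OF assms] .
qed (use assms in simp)

text \<open>With x, y, z the cubes of E(q), E(q^3), E(q^9), one has A = y/x and B = z/y. Multiplying
  \<open>euler_cubic\<close> by A^3 eliminates x and z, after which y^4 cancels.\<close>

lemma T_fps_3_cubic:
  defines "A \<equiv> T_fps 3" and "B \<equiv> T_fps 3 oo fps_X ^ 3"
  shows "A ^ 3 = B + 9 * fps_X * A * B ^ 2 + 27 * fps_X ^ 2 * A ^ 2 * B ^ 3"
proof -
  define x y z where "x = (euler_fps 1 ^ 3 :: int fps)" and "y = (euler_fps 3 ^ 3 :: int fps)"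
    and "z = (euler_fps 9 ^ 3 :: int fps)"
  have A: "A * x = y" unfolding A_def x_def y_def by (rule T_fps_mult) simp
  have B: "B * y = z" using T_fps_mult_compose[of 3 3] by (simp add: B_def y_def z_def)
  have "z * (x ^ 3 + 9 * fps_X * x ^ 2 * z + 27 * fps_X ^ 2 * x * z ^ 2) = y ^ 4"
    using euler_cubic by (simp add: x_def y_def z_def power_mult[symmetric])
  hence "A ^ 3 * y ^ 4 = A ^ 3 * (z * (x ^ 3 + 9 * fps_X * x ^ 2 * z + 27 * fps_X ^ 2 * x * z ^ 2))" by simp
  also have "\<dots> = z * ((A * x) ^ 3 + 9 * fps_X * A * (A * x) ^ 2 * z + 27 * fps_X ^ 2 * A ^ 2 * (A * x) * z ^ 2)"
    by (simp add: power2_eq_square power3_eq_cube algebra_simps)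
  also have "\<dots> = B * y * (y ^ 3 + 9 * fps_X * A * y ^ 2 * (B * y) + 27 * fps_X ^ 2 * A ^ 2 * y * (B * y) ^ 2)"
    unfolding A unfolding B ..
  also have "\<dots> = (B + 9 * fps_X * A * B ^ 2 + 27 * fps_X ^ 2 * A ^ 2 * B ^ 3) * y ^ 4"
    by (simp add: eval_nat_numeral algebra_simps)
  finally show ?thesis
    using euler_fps_nonzero[of 3, where 'a=int] by (simp add: y_def)
qed

text \<open>With \<open>q = x\<^sup>4\<close> the eta quotient \<open>(\<eta>(3\<tau>)/\<eta>(\<tau>))\<^sup>3 = q\<^sup>1\<^sup>/\<^sup>4 E(q\<^sup>3)\<^sup>3/E(q)\<^sup>3\<close>
  becomes a power series in \<open>x\<close>; likewise \<open>eta_fps m\<close> is \<open>(\<eta>(3\<^sup>m\<tau>)/\<eta>(\<tau>))\<^sup>3\<close>.\<close>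

definition eta_fps :: "nat \<Rightarrow> int fps" where
  "eta_fps m = fps_X ^ ((3 ^ m - 1) div 2) * (T_fps (3 ^ m) oo fps_X ^ 4)"

abbreviation hauptmodul :: "int fps" where "hauptmodul \<equiv> eta_fps 1"

lemma eta_fps_0: "eta_fps 0 = 1"
  using T_fps_1 by (simp add: eta_fps_def)

lemma eta_fps_Suc: "eta_fps (Suc m) = hauptmodul * (eta_fps m oo fps_X ^ 3)"
proof -
  have "T_fps (3 ^ Suc m) oo fps_X ^ 4 = (T_fps 3 * (T_fps (3 ^ m) oo fps_X ^ 3)) oo fps_X ^ 4"
    using T_fps_mult_index[of "3 ^ m" 3] by (simp add: mult.commute)
  also have "\<dots> = (T_fps 3 oo fps_X ^ 4) * ((T_fps (3 ^ m) oo fps_X ^ 4) oo fps_X ^ 3)"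
    by (subst fps_compose_mult_distrib) (simp_all add: fps_compose_X_power_assoc)
  finally have T: "T_fps (3 ^ Suc m) oo fps_X ^ 4 = \<dots>" .
  \<comment> \<open>Oddness makes the division by 2 in the exponent exact.\<close>
  have "odd ((3::nat) ^ m)" by simp
  then obtain c where c: "(3::nat) ^ m = 2 * c + 1" by (elim oddE)
  have e: "((3::nat) ^ Suc m - 1) div 2 = 1 + ((3 ^ m - 1) div 2) * 3" by (simp add: c)
  have "eta_fps m oo fps_X ^ 3 = fps_X ^ (((3 ^ m - 1) div 2) * 3) * ((T_fps (3 ^ m) oo fps_X ^ 4) oo fps_X ^ 3)"
    unfolding eta_fps_def
    by (subst fps_compose_mult_distrib) (simp, simp only: fps_X_power_compose_X_power zero_less_numeral)
  moreover have "hauptmodul = fps_X ^ 1 * (T_fps 3 oo fps_X ^ 4)"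
    by (simp add: eta_fps_def)
  ultimately show ?thesis unfolding eta_fps_def[of "Suc m"] T e power_add by (simp only: mult_ac)
qed

lemma hauptmodul_cubic:
  defines "b \<equiv> hauptmodul oo fps_X ^ 3"
  shows "hauptmodul ^ 3 = b + 9 * hauptmodul * b ^ 2 + 27 * hauptmodul ^ 2 * b ^ 3"
proof -
  define A B where "A = T_fps 3 oo fps_X ^ 4" and "B = (T_fps 3 oo fps_X ^ 3) oo fps_X ^ 4"
  let ?X = "fps_X :: int fps"
  have a: "hauptmodul = ?X * A" by (simp add: eta_fps_def A_def)
  have "B = (T_fps 3 oo fps_X ^ 4) oo fps_X ^ 3" unfolding B_def by (simp add: fps_compose_X_power_assoc)
  hence b: "b = ?X ^ 3 * B" unfolding b_def a A_def by (subst fps_compose_mult_distrib) simp_all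
  have "(T_fps 3) ^ 3 oo ?X ^ 4 = ((T_fps 3 oo fps_X ^ 3) + 9 * fps_X * T_fps 3 * (T_fps 3 oo fps_X ^ 3) ^ 2
     + 27 * fps_X ^ 2 * T_fps 3 ^ 2 * (T_fps 3 oo fps_X ^ 3) ^ 3) oo ?X ^ 4"
    by (simp only: T_fps_3_cubic)
  moreover have X40: "fps_nth (?X ^ 4) 0 = 0" by simp
  moreover have "?X ^ 2 oo ?X ^ 4 = ?X ^ 8" by (simp add: fps_X_power_compose_X_power)
  ultimately have "A ^ 3 = B + 9 * ?X ^ 4 * A * B ^ 2 + 27 * ?X ^ 8 * A ^ 2 * B ^ 3"
    by (simp only: fps_compose_add_distrib fps_compose_mult_distrib[OF X40] fps_compose_power[OF X40, symmetric]
         numeral_compose fps_X_fps_compose_startby0[OF X40] A_def[symmetric] B_def[symmetric] power_mult[symmetric])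
  hence "?X ^ 3 * A ^ 3 = ?X ^ 3 * (B + 9 * ?X ^ 4 * A * B ^ 2 + 27 * ?X ^ 8 * A ^ 2 * B ^ 3)" by simp
  moreover have "?X ^ 3 * (B + 9 * ?X ^ 4 * A * B ^ 2 + 27 * ?X ^ 8 * A ^ 2 * B ^ 3) =
     ?X ^ 3 * B + 9 * (?X * A) * (?X ^ 3 * B) ^ 2 + 27 * (?X * A) ^ 2 * (?X ^ 3 * B) ^ 3"
    by (simp add: power_mult_distrib power_mult[symmetric]) (simp add: algebra_simps eval_nat_numeral)
  ultimately show ?thesis unfolding a b by (simp add: power_mult_distrib)
qed

section \<open>The operator \<open>U3\<close> and its values on powers of the Hauptmodul\<close>

definition U3 :: "'a::comm_ring_1 fps \<Rightarrow> 'a fps" where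
  "U3 f = Abs_fps (\<lambda>n. fps_nth f (3 * n))"

lemma U3_nth [simp]: "fps_nth (U3 f) n = fps_nth f (3 * n)"
  by (simp add: U3_def)

lemma U3_add: "U3 (f + g) = U3 f + U3 g"
  by (rule fps_ext) simp

lemma U3_0 [simp]: "U3 0 = 0" and U3_1 [simp]: "U3 1 = 1"
  by (rule fps_ext; simp)+

text \<open>\<open>U3\<close> is linear over series in x^3: since \<open>g oo fps_X ^ 3\<close> has
  only exponents divisible by 3, it meets just those terms of \<open>f\<close> that
  \<open>U3\<close> keeps.\<close>

lemma U3_mult_compose: "U3 (f * (g oo fps_X ^ 3)) = U3 f * g"
proof (rule fps_ext)
  fix n
  have "fps_nth (U3 (f * (g oo fps_X ^ 3))) n =
     (\<Sum>i\<le>3*n. if 3 dvd (3 * n - i) then fps_nth f i * fps_nth g ((3 * n - i) div 3) else 0)"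
    by (simp add: fps_mult_nth fps_nth_compose_X_power atLeast0AtMost if_distrib cong: if_cong)
  also have "\<dots> = (\<Sum>i\<in>{i\<in>{..3*n}. 3 dvd (3 * n - i)}. fps_nth f i * fps_nth g ((3 * n - i) div 3))"
    by (simp only: sum.inter_filter[OF finite_atMost])
  also have "{i\<in>{..3*n}. 3 dvd (3 * n - i)} = (\<lambda>j. 3 * j) ` {..n}"
  proof (intro equalityI subsetI)
    fix i assume "i \<in> {i\<in>{..3*n}. 3 dvd (3 * n - i)}"
    hence "i = 3 * (i div 3)" "i div 3 \<le> n" by auto presburger
    thus "i \<in> (\<lambda>j. 3 * j) ` {..n}" by blast
  qed auto
  also have "(\<Sum>i\<in>(\<lambda>j. 3 * j) ` {..n}. fps_nth f i * fps_nth g ((3 * n - i) div 3))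
     = (\<Sum>j\<le>n. fps_nth f (3 * j) * fps_nth g (n - j))"
    by (subst sum.reindex) (auto simp: inj_on_def diff_mult_distrib2[symmetric] simp del: diff_mult_distrib2)
  also have "\<dots> = fps_nth (U3 f * g) n"
    by (simp add: fps_mult_nth atLeast0AtMost)
  finally show "fps_nth (U3 (f * (g oo fps_X ^ 3))) n = fps_nth (U3 f * g) n" .
qed

lemma U3_of_int_mult: "U3 (of_int c * f) = of_int c * U3 f"
proof -
  have "of_int c = (of_int c oo fps_X ^ 3 :: 'a::comm_ring_1 fps)"
    by (simp add: fps_of_int [symmetric])
  thus ?thesis using U3_mult_compose[of f "of_int c"] by (simp add: mult.commute)
qed

lemma U3_eta_fps:
  "U3 (f * eta_fps (Suc m)) = U3 (f * hauptmodul) * eta_fps m"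
  unfolding eta_fps_Suc by (simp only: U3_mult_compose mult.assoc [symmetric])

text \<open>All factors of \<open>eta_fps m\<close> but the first are series in x^3. They pass
  through \<open>U3\<close> with x^3 replaced by x, and the next factor becomes the Hauptmodul
  itself.\<close>

lemma funpow_U3_eta_fps:
  "k \<le> m \<Longrightarrow> (U3 ^^ k) (eta_fps m) = ((\<lambda>f. U3 (f * hauptmodul)) ^^ k) 1 * eta_fps (m - k)"
proof (induction k)
  case (Suc k)
  hence e: "m - k = Suc (m - Suc k)" by simp
  have "(U3 ^^ k) (eta_fps m) = ((\<lambda>f. U3 (f * hauptmodul)) ^^ k) 1 * eta_fps (Suc (m - Suc k))"
    using Suc unfolding e [symmetric] by simp
  thus ?case by (simp only: funpow.simps o_apply U3_eta_fps)
qed simp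

lemma funpow_U3_nth: "fps_nth ((U3 ^^ k) f) n = fps_nth f (3 ^ k * n)"
  by (induction k arbitrary: n) (simp_all add: mult_ac)

text \<open>The coefficients of the cubic equation are series in x^3, hence scalars for
  \<open>U3\<close>, which turns \<open>hauptmodul oo fps_X ^ 3\<close> into
  \<open>hauptmodul\<close>.\<close>

lemma U3_hauptmodul_power_recursion:
  "U3 (hauptmodul ^ (j + 3)) = hauptmodul * U3 (hauptmodul ^ j)
     + 9 * hauptmodul ^ 2 * U3 (hauptmodul ^ (j + 1)) + 27 * hauptmodul ^ 3 * U3 (hauptmodul ^ (j + 2))"
proof -
  let ?a = hauptmodul
  have "?a ^ (j + 3) = ?a ^ j * ?a ^ 3" by (simp add: power_add)
  also have "\<dots> = ?a ^ j * ((?a oo fps_X ^ 3) + 9 * ?a * (?a oo fps_X ^ 3) ^ 2 + 27 * ?a ^ 2 * (?a oo fps_X ^ 3) ^ 3)"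
    by (subst hauptmodul_cubic) (rule refl)
  also have "\<dots> = ?a ^ j * (?a oo fps_X ^ 3) + ?a ^ (j + 1) * (9 * (?a oo fps_X ^ 3) ^ 2)
      + ?a ^ (j + 2) * (27 * (?a oo fps_X ^ 3) ^ 3)"
    by (simp only: distrib_left mult_ac power_add power_one_right)
  also have "9 * (?a oo fps_X ^ 3) ^ 2 = (9 * ?a ^ 2) oo fps_X ^ 3"
    by (simp add: fps_compose_mult_distrib fps_compose_power)
  also have "27 * (?a oo fps_X ^ 3) ^ 3 = (27 * ?a ^ 3) oo fps_X ^ 3"
    by (simp add: fps_compose_mult_distrib fps_compose_power)
  finally have "?a ^ (j + 3) = ?a ^ j * (?a oo fps_X ^ 3) + ?a ^ (j + 1) * ((9 * ?a ^ 2) oo fps_X ^ 3)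
      + ?a ^ (j + 2) * ((27 * ?a ^ 3) oo fps_X ^ 3)" .
  thus ?thesis by (simp only: U3_add U3_mult_compose mult_ac)
qed

lemma fps_eq_U3_compose:
  assumes "\<And>n. n mod 3 \<noteq> 0 \<Longrightarrow> fps_nth f n = 0"
  shows "f = U3 f oo fps_X ^ 3"
  using assms by (auto intro!: fps_ext simp: fps_nth_compose_X_power dvd_eq_mod_eq_0)

lemma U3_X_power_mult_compose:
  "U3 (fps_X ^ n * (f oo fps_X ^ 3)) = (if 3 dvd n then fps_X ^ (n div 3) * f else 0)"
proof -
  have "U3 (fps_X ^ n) = (if 3 dvd n then fps_X ^ (n div 3) else 0 :: 'a::comm_ring_1 fps)"
    by (rule fps_ext) (auto simp: fps_X_power_nth, presburger?)
  thus ?thesis by (simp add: U3_mult_compose)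
qed

text \<open>\<open>E(q)\<^sup>3 = P - 3q E(q\<^sup>9)\<^sup>3\<close> with \<open>P\<close> a series in \<open>q\<^sup>3\<close>, and
  \<open>E(q\<^sup>9)\<^sup>3 (P\<^sup>3 - 27q\<^sup>3 E(q\<^sup>9)\<^sup>9) = E(q\<^sup>3)\<^sup>1\<^sup>2\<close>, rewritten in \<open>x\<close> with \<open>q = x\<^sup>4\<close>.\<close>

lemma hauptmodul_trisection:
  obtains e p :: "int fps" where "e \<noteq> 0" "hauptmodul * e = fps_X * (e oo fps_X ^ 3)"
    "e = (p oo fps_X ^ 3) - 3 * fps_X ^ 4 * ((e oo fps_X ^ 3) oo fps_X ^ 3)"
    "(e oo fps_X ^ 3) * p ^ 3 = e ^ 4 + 27 * fps_X ^ 4 * (e oo fps_X ^ 3) ^ 4"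
proof -
  let ?X = "fps_X :: int fps"
  define e where "e = (euler_fps 1 ^ 3 oo ?X ^ 4)"
  define P where "P = e + 3 * ?X ^ 4 * ((e oo ?X ^ 3) oo ?X ^ 3)"
  define p where "p = U3 P"
  have E: "euler_fps r ^ 3 oo ?X ^ 4 = euler_fps (r * 4) ^ 3" if "r > 0" for r
    using that by (simp add: euler_fps_power_compose)
  have e: "e = euler_fps 4 ^ 3" "e oo ?X ^ 3 = euler_fps 12 ^ 3"
      "(e oo ?X ^ 3) oo ?X ^ 3 = euler_fps 36 ^ 3"
    using E[of 1] by (simp_all add: e_def euler_fps_power_compose del: One_nat_def)
  have PJ: "P = (jacobi_fps + 3 * fps_X * (jacobi_fps oo fps_X ^ 9)) oo ?X ^ 4"
    unfolding P_def e_def euler_fps_cube [symmetric]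
    by (simp add: fps_compose_add_distrib fps_compose_mult_distrib euler_fps_power_compose del: One_nat_def)
  have "fps_nth P n = 0" if "n mod 3 \<noteq> 0" for n
  proof -
    \<comment> \<open>Since 4 is 1 modulo 3, the substitution q = x^4 preserves the classes of
      exponents modulo 3.\<close>
    have "(n div 4) mod 3 \<noteq> 0" if "4 dvd n" using that \<open>n mod 3 \<noteq> 0\<close> by presburger
    thus ?thesis unfolding PJ
      using jacobi_fps_trisection[of "n div 4", where 'a=int] by (simp only: fps_nth_compose_X_power) simp
  qed
  hence P: "P = p oo ?X ^ 3" unfolding p_def by (rule fps_eq_U3_compose)
  show ?thesis
  proof
    show e0: "e \<noteq> 0" unfolding e(1) using euler_fps_nonzero[of 4, where 'a=int] by simp
    show "hauptmodul * e = ?X * (e oo ?X ^ 3)"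
    proof -
      have "hauptmodul * e = ?X * ((T_fps 3 * euler_fps 1 ^ 3) oo ?X ^ 4)"
        by (simp add: eta_fps_def e_def fps_compose_mult_distrib)
      thus ?thesis by (simp add: T_fps_mult e euler_fps_power_compose del: One_nat_def)
    qed
    show "e = (p oo ?X ^ 3) - 3 * ?X ^ 4 * ((e oo ?X ^ 3) oo ?X ^ 3)"
      unfolding P [symmetric] P_def by simp
    define e3 where "e3 = e oo ?X ^ 3"
    define e9 where "e9 = e3 oo ?X ^ 3"
    have X40: "fps_nth (?X ^ 4) 0 = 0" by simp
    have cubic: "e9 * (e ^ 3 + 9 * ?X ^ 4 * e ^ 2 * e9 + 27 * ?X ^ 8 * e * e9 ^ 2) = e3 ^ 4"
    proof -
      have "(euler_fps 9 ^ 3 * (euler_fps 1 ^ 9 + 9 * fps_X * euler_fps 1 ^ 6 * euler_fps 9 ^ 3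
       + 27 * fps_X ^ 2 * euler_fps 1 ^ 3 * euler_fps 9 ^ 6)) oo ?X ^ 4 = euler_fps 3 ^ 12 oo ?X ^ 4"
        by (simp only: euler_cubic)
      thus ?thesis
        unfolding e3_def e9_def e
        by (simp add: fps_compose_add_distrib fps_compose_mult_distrib euler_fps_power_compose
           power_mult [symmetric] fps_X_power_compose_X_power del: One_nat_def)
    qed
    have "e9 * (P ^ 3 - 27 * ?X ^ 12 * e9 ^ 3) = e9 * (e ^ 3 + 9 * ?X ^ 4 * e ^ 2 * e9 + 27 * ?X ^ 8 * e * e9 ^ 2)"
    proof -
      have "(e + 3 * y * e9) ^ 3 - 27 * y ^ 3 * e9 ^ 3 = e ^ 3 + 9 * y * e ^ 2 * e9 + 27 * y ^ 2 * e * e9 ^ 2" for y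
        by (simp add: power2_eq_square power3_eq_cube algebra_simps)
      from this[of "?X ^ 4"] show ?thesis
        unfolding P_def e3_def[symmetric] e9_def[symmetric] by (simp add: power_mult [symmetric])
    qed
    hence "e9 * P ^ 3 = e3 ^ 4 + 27 * ?X ^ 12 * e9 ^ 4"
      unfolding cubic by (simp add: algebra_simps eval_nat_numeral)
    hence "(e3 * p ^ 3) oo ?X ^ 3 = (e ^ 4 + 27 * ?X ^ 4 * e3 ^ 4) oo ?X ^ 3"
      unfolding P e9_def e3_def
      by (simp add: fps_compose_add_distrib fps_compose_mult_distrib fps_compose_power fps_X_power_compose_X_power)
    \<comment> \<open>Applying \<open>U3\<close> undoes the substitution of x^3; the factor 1 brings
      both sides into the form of \<open>U3_mult_compose\<close>.\<close>
    hence "U3 (1 * ((e3 * p ^ 3) oo ?X ^ 3)) = U3 (1 * ((e ^ 4 + 27 * ?X ^ 4 * e3 ^ 4) oo ?X ^ 3))" by simp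
    thus "e3 * p ^ 3 = e ^ 4 + 27 * ?X ^ 4 * e3 ^ 4" unfolding U3_mult_compose by simp
  qed
qed

text \<open>The denominator \<open>e = P - Y\<close> of the Hauptmodul is rationalised by the
  cofactor P^2 + PY + Y^2. The new denominator is a series in x^3, and the numerator can be sorted
  by exponents modulo 3.\<close>

lemma U3_hauptmodul: "U3 hauptmodul = 9 * hauptmodul ^ 3"
  and U3_hauptmodul_square: "U3 (hauptmodul ^ 2) = 6 * hauptmodul ^ 2 + 243 * hauptmodul ^ 6"
proof -
  let ?X = "fps_X :: int fps"
  obtain e p :: "int fps" where e0: "e \<noteq> 0" and ae: "hauptmodul * e = fps_X * (e oo fps_X ^ 3)"
    and ep: "e = (p oo fps_X ^ 3) - 3 * fps_X ^ 4 * ((e oo fps_X ^ 3) oo fps_X ^ 3)"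
    and pc: "(e oo fps_X ^ 3) * p ^ 3 = e ^ 4 + 27 * fps_X ^ 4 * (e oo fps_X ^ 3) ^ 4"
    by (rule hauptmodul_trisection)
  define e3 e9 P Y where "e3 = e oo ?X ^ 3" and "e9 = e3 oo ?X ^ 3" and "P = p oo ?X ^ 3" and "Y = 3 * ?X ^ 4 * e9"
  have X30: "fps_nth (?X ^ 3) 0 = 0" by simp
  note comp = fps_compose_mult_distrib[OF X30] fps_compose_power[OF X30] fps_compose_add_distrib
  have e30: "e3 \<noteq> 0"
    using e0 unfolding e3_def by (simp add: fps_compose_eq_0_iff)
  have ePY: "e = P - Y" using ep unfolding P_def Y_def e9_def e3_def .
  have "(e3 * p ^ 3) oo ?X ^ 3 = (e ^ 4 + 27 * ?X ^ 4 * e3 ^ 4) oo ?X ^ 3"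
    using pc by (simp only: e3_def)
  hence c: "e9 * P ^ 3 = e3 ^ 4 + 27 * ?X ^ 12 * e9 ^ 4"
    by (simp add: fps_compose_add_distrib fps_compose_mult_distrib fps_compose_power[symmetric]
      fps_X_power_compose_X_power P_def e9_def e3_def[symmetric])
  have Y3: "Y ^ 3 = 27 * ?X ^ 12 * e9 ^ 3"
    unfolding Y_def by (simp add: power_mult_distrib power_mult [symmetric])
  have c': "e3 ^ 4 = e9 * ((P - Y) * (P ^ 2 + P * Y + Y ^ 2))"
  proof -
    have "(P - Y) * (P ^ 2 + P * Y + Y ^ 2) = P ^ 3 - Y ^ 3"
      by (simp add: power2_eq_square power3_eq_cube algebra_simps)
    moreover have "e9 * (P ^ 3 - Y ^ 3) = e3 ^ 4"
      unfolding Y3 right_diff_distrib c by (simp add: eval_nat_numeral)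
    ultimately show ?thesis by simp
  qed
  have "e3 * (hauptmodul * e3 ^ 3) = hauptmodul * e3 ^ 4"
    by (simp add: eval_nat_numeral)
  also have "\<dots> = (hauptmodul * e) * (e9 * (P ^ 2 + P * Y + Y ^ 2))"
    unfolding c' ePY by (simp only: mult_ac)
  also have "\<dots> = e3 * (?X * e9 * (P ^ 2 + P * Y + Y ^ 2))"
    unfolding ae e3_def by (simp only: mult_ac)
  finally have a: "hauptmodul * e3 ^ 3 = ?X * e9 * (P ^ 2 + P * Y + Y ^ 2)"
    using e30 by simp
  have Xm: "U3 (?X ^ n * (f oo ?X ^ 3)) = (if 3 dvd n then ?X ^ (n div 3) * f else 0)" for n f
    by (rule U3_X_power_mult_compose)
  \<comment> \<open>Of the leading exponents 1, 5 and 9 only 9 survives \<open>U3\<close>.\<close>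
  have "hauptmodul * (e ^ 3 oo ?X ^ 3) = ?X ^ 1 * ((e3 * p ^ 2) oo ?X ^ 3) + ?X ^ 5 * ((3 * p * e3 ^ 2) oo ?X ^ 3)
      + ?X ^ 9 * ((9 * e3 ^ 3) oo ?X ^ 3)"
  proof -
    have "hauptmodul * (e ^ 3 oo ?X ^ 3) = ?X * e9 * (P ^ 2 + P * Y + Y ^ 2)"
      using a by (simp add: e3_def fps_compose_power)
    also have "\<dots> = ?X ^ 1 * (e9 * P ^ 2) + ?X ^ 5 * (3 * P * e9 ^ 2) + ?X ^ 9 * (9 * e9 ^ 3)"
      unfolding Y_def by (simp add: power_mult_distrib algebra_simps eval_nat_numeral)
    finally show ?thesis
      by (simp add: fps_compose_mult_distrib fps_compose_power [symmetric] P_def e9_def)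
  qed
  hence "U3 (hauptmodul * (e ^ 3 oo ?X ^ 3)) = ?X ^ 3 * (9 * e3 ^ 3)"
    by (simp only: U3_add Xm) simp
  also have "\<dots> = 9 * hauptmodul ^ 3 * e ^ 3"
    using ae by (simp add: e3_def power_mult_distrib [symmetric] mult.assoc mult.left_commute)
  finally show "U3 hauptmodul = 9 * hauptmodul ^ 3"
    unfolding U3_mult_compose using e0 by simp
  \<comment> \<open>Of the leading exponents 2, 6, 10, 14 and 18 only 6 and 18 survive
    \<open>U3\<close>.\<close>
  have "hauptmodul ^ 2 * (e ^ 6 oo ?X ^ 3) = ?X ^ 2 * ((e3 ^ 2 * p ^ 4) oo ?X ^ 3) + ?X ^ 6 * ((6 * e3 ^ 3 * p ^ 3) oo ?X ^ 3)
      + ?X ^ 10 * ((27 * e3 ^ 4 * p ^ 2) oo ?X ^ 3) + ?X ^ 14 * ((54 * e3 ^ 5 * p) oo ?X ^ 3) + ?X ^ 18 * ((81 * e3 ^ 6) oo ?X ^ 3)"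
  proof -
    have "hauptmodul ^ 2 * (e ^ 6 oo ?X ^ 3) = (hauptmodul * e3 ^ 3) ^ 2"
      by (simp add: e3_def fps_compose_power power_mult_distrib power_mult [symmetric])
    also have "\<dots> = (?X * e9 * (P ^ 2 + P * Y + Y ^ 2)) ^ 2" by (simp only: a)
    also have "\<dots> = ?X ^ 2 * (e9 ^ 2 * P ^ 4) + ?X ^ 6 * (6 * e9 ^ 3 * P ^ 3) + ?X ^ 10 * (27 * e9 ^ 4 * P ^ 2)
        + ?X ^ 14 * (54 * e9 ^ 5 * P) + ?X ^ 18 * (81 * e9 ^ 6)"
      unfolding Y_def by (simp add: power_mult_distrib algebra_simps eval_nat_numeral)
    finally show ?thesis
      by (simp add: fps_compose_mult_distrib fps_compose_power [symmetric] P_def e9_def)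
  qed
  hence "U3 (hauptmodul ^ 2 * (e ^ 6 oo ?X ^ 3)) = ?X ^ 2 * (6 * e3 ^ 3 * p ^ 3) + ?X ^ 6 * (81 * e3 ^ 6)"
    by (simp only: U3_add Xm) simp
  \<comment> \<open>The relation \<open>pc\<close> now eliminates \<open>p\<close>; the top
    coefficient becomes 6 * 27 + 81 = 243.\<close>
  also have "?X ^ 2 * (6 * e3 ^ 3 * p ^ 3) = 6 * (?X * e3) ^ 2 * (e3 * p ^ 3)"
    by (simp add: eval_nat_numeral algebra_simps)
  also have "e3 * p ^ 3 = e ^ 4 + 27 * ?X ^ 4 * e3 ^ 4" using pc by (simp only: e3_def)
  also have "6 * (?X * e3) ^ 2 * (e ^ 4 + 27 * ?X ^ 4 * e3 ^ 4) + ?X ^ 6 * (81 * e3 ^ 6)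
      = 6 * (?X * e3) ^ 2 * e ^ 4 + 243 * (?X * e3) ^ 6"
    by (simp add: eval_nat_numeral algebra_simps)
  also have "\<dots> = (6 * hauptmodul ^ 2 + 243 * hauptmodul ^ 6) * e ^ 6"
    unfolding e3_def ae [symmetric] by (simp add: eval_nat_numeral algebra_simps)
  finally show "U3 (hauptmodul ^ 2) = 6 * hauptmodul ^ 2 + 243 * hauptmodul ^ 6"
    unfolding U3_mult_compose using e0 by simp
qed

lemma hauptmodul_nth_eq_0: "n mod 4 \<noteq> 1 \<Longrightarrow> fps_nth hauptmodul n = 0"
proof (cases n)
  case (Suc m)
  assume "n mod 4 \<noteq> 1"
  hence "\<not> 4 dvd m" using Suc by presburger
  thus ?thesis by (simp add: Suc eta_fps_def fps_nth_compose_X_power)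
qed (simp add: eta_fps_def)

lemma hauptmodul_nth: "fps_nth hauptmodul (4 * n + 1) = fps_nth (T_fps 3) n"
  by (simp add: eta_fps_def fps_nth_compose_X_power)

section \<open>Three-adic divisibility of the iterates\<close>

text \<open>The additive group generated by the \<open>of_int (D i) * hauptmodul ^ i\<close>. Only
  the existence of such an expansion is used, so coefficients never have to be extracted or shown to
  be unique.\<close>

inductive_set hauptmodul_span :: "(nat \<Rightarrow> int) \<Rightarrow> int fps set" for D where
  zero: "0 \<in> hauptmodul_span D"
| add: "f \<in> hauptmodul_span D \<Longrightarrow> of_int (D i * c) * hauptmodul ^ i + f \<in> hauptmodul_span D"

lemma hauptmodul_span_add:
  "f \<in> hauptmodul_span D \<Longrightarrow> g \<in> hauptmodul_span D \<Longrightarrow> f + g \<in> hauptmodul_span D"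
  by (induction f rule: hauptmodul_span.induct) (simp_all only: add_0 add.assoc hauptmodul_span.add)

lemma hauptmodul_span_monomial:
  assumes "D i dvd c"
  shows "of_int c * hauptmodul ^ i \<in> hauptmodul_span D"
proof -
  obtain d where "c = D i * d" using assms by blast
  thus ?thesis using hauptmodul_span.add[OF hauptmodul_span.zero, of D i d] by simp
qed

lemma hauptmodul_span_mult:
  assumes "f \<in> hauptmodul_span D" "\<And>i. D' (i + k) dvd c * D i"
  shows "of_int c * hauptmodul ^ k * f \<in> hauptmodul_span D'"
  using assms(1)
proof induction
  case zero
  show ?case by (simp add: hauptmodul_span.zero)
next
  case (add f i d)
  have "of_int (c * D i * d) * hauptmodul ^ (i + k) \<in> hauptmodul_span D'"
    using assms(2)[of i] by (intro hauptmodul_span_monomial) (rule dvd_mult2)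
  from hauptmodul_span_add[OF this add.IH] show ?case
    by (simp add: algebra_simps power_add)
qed

text \<open>The entries of the matrix of \<open>U3\<close> on powers of the Hauptmodul are divisible by these.
  The slopes are those of the extreme terms \<open>i = 3j\<close> of \<open>U3 (hauptmodul ^ j)\<close>; zero forces
  a coefficient to vanish.\<close>

definition U3_divisor :: "nat \<Rightarrow> nat \<Rightarrow> int" where
  "U3_divisor j i = (if i mod 4 = (3 * j) mod 4 \<and> j \<le> 3 * i \<and> i \<le> 3 * j then 3 ^ ((9*i - 3*j - 1) div 8) else 0)"

lemma if_power_dvd:
  fixes a :: "'a::comm_semiring_1"
  assumes "Q \<Longrightarrow> P \<and> l \<le> m + n"
  shows "(if P then a ^ l else 0) dvd a ^ m * (if Q then a ^ n else 0)"
  using assms by (auto simp: power_add [symmetric] intro: le_imp_power_dvd)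

lemma div_8_le_add: "a \<le> 8 * m + c \<Longrightarrow> a div 8 \<le> m + (c::nat) div 8"
  using div_le_mono[of a "8 * m + c" 8] by simp

text \<open>The remainders of \<open>b\<close> and \<open>c\<close> sum to at most 14; a slack of 7
  brings this below 8.\<close>

lemma div_8_le_add2: "a + 7 \<le> b + c \<Longrightarrow> a div 8 \<le> b div 8 + (c::nat) div 8"
  using div_mult_mod_eq[of a 8] div_mult_mod_eq[of b 8] div_mult_mod_eq[of c 8]
    mod_less_divisor[of 8 b] mod_less_divisor[of 8 c] by linarith

text \<open>Apart from truncation, \<open>9*i - 3*j - 1\<close> grows by 0, 12 and 24 in the three
  cases. This is at most 8 times the exponents 0, 2, 3 of the coefficients 1, 9, 27 in the
  recursion.\<close>

lemma U3_divisor_recursion: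
  "U3_divisor (k + 3) (i + 1) dvd 3 ^ 0 * U3_divisor k i"
  "U3_divisor (k + 3) (i + 2) dvd 3 ^ 2 * U3_divisor (k + 1) i"
  "U3_divisor (k + 3) (i + 3) dvd 3 ^ 3 * U3_divisor (k + 2) i"
proof -
  have m: "i mod 4 = (3 * k) mod 4 \<Longrightarrow> (i + 1) mod 4 = (3 * (k + 3)) mod 4"
    "i mod 4 = (3 * (k + 1)) mod 4 \<Longrightarrow> (i + 2) mod 4 = (3 * (k + 3)) mod 4"
    "i mod 4 = (3 * (k + 2)) mod 4 \<Longrightarrow> (i + 3) mod 4 = (3 * (k + 3)) mod 4"
  proof -
    have shift: "i mod 4 = x mod 4 \<Longrightarrow> (i + c) mod 4 = (x + c) mod 4" for x c :: nat
      by (metis mod_add_left_eq)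
    have "3 * (k + 3) = (3 * k + 1) + 4 * 2" "3 * (k + 3) = 3 * (k + 1) + 2 + 4 * 1" "3 * (k + 3) = 3 * (k + 2) + 3"
      by simp_all
    thus "i mod 4 = (3 * k) mod 4 \<Longrightarrow> (i + 1) mod 4 = (3 * (k + 3)) mod 4"
    "i mod 4 = (3 * (k + 1)) mod 4 \<Longrightarrow> (i + 2) mod 4 = (3 * (k + 3)) mod 4"
    "i mod 4 = (3 * (k + 2)) mod 4 \<Longrightarrow> (i + 3) mod 4 = (3 * (k + 3)) mod 4"
      using shift mod_mult_self2 by metis+
  qed
  show "U3_divisor (k + 3) (i + 1) dvd 3 ^ 0 * U3_divisor k i"
    unfolding U3_divisor_def
    by (rule if_power_dvd, intro conjI div_8_le_add) ((elim conjE, erule m) | auto)+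
  show "U3_divisor (k + 3) (i + 2) dvd 3 ^ 2 * U3_divisor (k + 1) i"
    unfolding U3_divisor_def
    by (rule if_power_dvd, intro conjI div_8_le_add) ((elim conjE, erule m) | auto)+
  show "U3_divisor (k + 3) (i + 3) dvd 3 ^ 3 * U3_divisor (k + 2) i"
    unfolding U3_divisor_def
    by (rule if_power_dvd, intro conjI div_8_le_add) ((elim conjE, erule m) | auto)+
qed

lemma U3_hauptmodul_power: "U3 (hauptmodul ^ j) \<in> hauptmodul_span (U3_divisor j)"
proof (induction j rule: less_induct)
  case (less j)
  consider "j = 0" | "j = 1" | "j = 2" | k where "j = k + 3"
    by (metis One_nat_def Suc_1 add.commute less_2_cases_iff less_Suc_eq not_less_eq numeral_3_eq_3 ordered_cancel_comm_monoid_diff_class.add_diff_inverse not_less)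
  thus ?case
  proof cases
    case 1
    have "of_int 1 * hauptmodul ^ 0 \<in> hauptmodul_span (U3_divisor 0)"
      by (intro hauptmodul_span_monomial) (simp add: U3_divisor_def)
    thus ?thesis by (simp add: 1)
  next
    case 2
    have "of_int 9 * hauptmodul ^ 3 \<in> hauptmodul_span (U3_divisor 1)"
      by (intro hauptmodul_span_monomial) (simp add: U3_divisor_def)
    thus ?thesis by (simp add: 2 U3_hauptmodul del: One_nat_def)
  next
    case 3
    have "of_int 6 * hauptmodul ^ 2 + of_int 243 * hauptmodul ^ 6 \<in> hauptmodul_span (U3_divisor 2)"
      by (intro hauptmodul_span_add hauptmodul_span_monomial) (simp_all add: U3_divisor_def)
    thus ?thesis by (simp add: 3 U3_hauptmodul_square del: One_nat_def)
  next
    case 4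
    have "of_int (3 ^ 0) * hauptmodul ^ 1 * U3 (hauptmodul ^ k) \<in> hauptmodul_span (U3_divisor j)"
      unfolding 4 by (rule hauptmodul_span_mult[OF less U3_divisor_recursion(1)]) (simp add: 4)
    moreover have "of_int (3 ^ 2) * hauptmodul ^ 2 * U3 (hauptmodul ^ (k + 1)) \<in> hauptmodul_span (U3_divisor j)"
      unfolding 4 by (rule hauptmodul_span_mult[OF less U3_divisor_recursion(2)]) (simp add: 4)
    moreover have "of_int (3 ^ 3) * hauptmodul ^ 3 * U3 (hauptmodul ^ (k + 2)) \<in> hauptmodul_span (U3_divisor j)"
      unfolding 4 by (rule hauptmodul_span_mult[OF less U3_divisor_recursion(3)]) (simp add: 4)
    ultimately show ?thesis
      unfolding 4 U3_hauptmodul_power_recursion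
      by (intro hauptmodul_span_add) (simp_all del: One_nat_def)
  qed
qed

lemma U3_hauptmodul_span:
  assumes "f \<in> hauptmodul_span D" "\<And>i j. D' j dvd D i * U3_divisor (i + k) j"
  shows "U3 (f * hauptmodul ^ k) \<in> hauptmodul_span D'"
  using assms(1)
proof induction
  case zero
  show ?case by (simp add: hauptmodul_span.zero)
next
  case (add f i c)
  have "of_int (D i * c) * hauptmodul ^ 0 * U3 (hauptmodul ^ (i + k)) \<in> hauptmodul_span D'"
    using assms(2)[of _ i] by (intro hauptmodul_span_mult[OF U3_hauptmodul_power]) (simp add: mult_ac)
  moreover have "U3 ((of_int (D i * c) * hauptmodul ^ i + f) * hauptmodul ^ k)
      = of_int (D i * c) * hauptmodul ^ 0 * U3 (hauptmodul ^ (i + k)) + U3 (f * hauptmodul ^ k)"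
    by (simp only: U3_add [symmetric] U3_of_int_mult [symmetric] power_add distrib_right power_0 mult_1_right mult.assoc)
  ultimately show ?case using add.IH by (simp only: hauptmodul_span_add)
qed

lemma hauptmodul_span_dvd_nth:
  assumes "f \<in> hauptmodul_span D" "\<And>i. m dvd D i * fps_nth (hauptmodul ^ i) n"
  shows "m dvd fps_nth f n"
  using assms(1)
proof induction
  case (add f i c)
  have "fps_nth (of_int (D i * c) * hauptmodul ^ i) n = D i * fps_nth (hauptmodul ^ i) n * c"
    by (simp add: fps_of_int [symmetric] mult_ac del: fps_const_mult of_int_mult)
  thus ?case using add.IH assms(2)[of i] by (simp only: fps_add_nth dvd_add dvd_mult2)
qed simp

text \<open>Weights preserved by the iteration. A step
  \<open>f \<mapsto> U3 (f * hauptmodul)\<close> leads from odd to even or back, and a plain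
  \<open>U3\<close> from odd to square or back. The offsets 24, 13, 10 give the lowest degrees 3, 4,
  1 the exponents N, N+2, N; the last one relies on truncated subtraction.\<close>

definition odd_divisor :: "nat \<Rightarrow> nat \<Rightarrow> int" where
  "odd_divisor N i = (if i mod 4 = 3 then 3 ^ (N + (9*i - 24) div 8) else 0)"

definition even_divisor :: "nat \<Rightarrow> nat \<Rightarrow> int" where
  "even_divisor N i = (if i mod 4 = 0 \<and> i > 0 then 3 ^ (N + (9*i - 13) div 8) else 0)"

definition square_divisor :: "nat \<Rightarrow> nat \<Rightarrow> int" where
  "square_divisor N i = (if i mod 4 = 1 then 3 ^ (N + (9*i - 10) div 8) else 0)"

lemma if_power_dvd_mult:
  fixes a :: "'a::comm_semiring_1"
  assumes "Q \<Longrightarrow> R \<Longrightarrow> P" "Q \<Longrightarrow> R \<Longrightarrow> l \<le> m + n"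
  shows "(if P then a ^ l else 0) dvd (if R then a ^ m else 0) * (if Q then a ^ n else 0)"
  using assms by (auto simp: power_add [symmetric] intro: le_imp_power_dvd)

lemma even_divisor_dvd: "even_divisor N j dvd odd_divisor N i * U3_divisor (i + 1) j"
  unfolding even_divisor_def odd_divisor_def U3_divisor_def
proof (rule if_power_dvd_mult)
  assume *: "j mod 4 = 3 * (i + 1) mod 4 \<and> i + 1 \<le> 3 * j \<and> j \<le> 3 * (i + 1)" "i mod 4 = 3"
  show "j mod 4 = 0 \<and> 0 < j"
  proof -
    have "3 * (i + 1) mod 4 = 0" using *(2) by presburger
    thus ?thesis using * by auto
  qed
  \<comment> \<open>For \<open>i = 3\<close> the first summand on the right is 0 and equality holds;
    from \<open>i = 7\<close> on the slack exceeds 7.\<close>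
  have "(9 * j - 13) div 8 \<le> (9 * i - 24) div 8 + (9 * j - 3 * (i + 1) - 1) div 8"
  proof (cases "i = 3")
    case False
    hence "7 \<le> i" using *(2) by presburger
    thus ?thesis using * by (intro div_8_le_add2) auto
  qed simp
  thus "N + (9 * j - 13) div 8 \<le> N + (9 * i - 24) div 8 + (9 * j - 3 * (i + 1) - 1) div 8" by simp
qed

lemma odd_divisor_dvd_even: "odd_divisor (N + 3) j dvd even_divisor N i * U3_divisor (i + 1) j"
  unfolding even_divisor_def odd_divisor_def U3_divisor_def
proof (rule if_power_dvd_mult)
  assume *: "j mod 4 = 3 * (i + 1) mod 4 \<and> i + 1 \<le> 3 * j \<and> j \<le> 3 * (i + 1)" "i mod 4 = 0 \<and> 0 < i"
  show j: "j mod 4 = 3"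
  proof -
    have "3 * (i + 1) mod 4 = 3" using *(2) by presburger
    thus ?thesis using * by auto
  qed
  have "4 \<le> i" "3 \<le> j" using *(2) j by presburger+
  \<comment> \<open>The gain of 3 is absorbed as 24 = 8 * 3; the slack needed is then exactly 6 * i
    \<ge> 24.\<close>
  hence "(9 * j) div 8 \<le> (9 * i - 13) div 8 + (9 * j - 3 * (i + 1) - 1) div 8"
    by (intro div_8_le_add2) auto
  moreover have "(9 * j) div 8 = 3 + (9 * j - 24) div 8" using \<open>3 \<le> j\<close> by auto
  ultimately show "N + 3 + (9 * j - 24) div 8 \<le> N + (9 * i - 13) div 8 + (9 * j - 3 * (i + 1) - 1) div 8"
    by simp
qed

lemma square_divisor_dvd: "square_divisor N j dvd odd_divisor N i * U3_divisor (i + 0) j"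
  unfolding square_divisor_def odd_divisor_def U3_divisor_def
proof (rule if_power_dvd_mult)
  assume *: "j mod 4 = 3 * (i + 0) mod 4 \<and> i + 0 \<le> 3 * j \<and> j \<le> 3 * (i + 0)" "i mod 4 = 3"
  show "j mod 4 = 1"
  proof -
    have "3 * i mod 4 = 1" using *(2) by presburger
    thus ?thesis using * by auto
  qed
  have "(9 * j - 10) div 8 \<le> (9 * i - 24) div 8 + (9 * j - 3 * (i + 0) - 1) div 8"
  proof (cases "i = 3")
    case False
    hence "7 \<le> i" using *(2) by presburger
    thus ?thesis using * by (intro div_8_le_add2) auto
  qed simp
  thus "N + (9 * j - 10) div 8 \<le> N + (9 * i - 24) div 8 + (9 * j - 3 * (i + 0) - 1) div 8" by simp
qed

text \<open>The entry \<open>i = 1\<close>, \<open>j = 3\<close>, that is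
  \<open>U3 hauptmodul = 9 * hauptmodul ^ 3\<close>, limits the gain to 2; larger \<open>i\<close>
  leave enough slack.\<close>

lemma odd_divisor_dvd_square: "odd_divisor (N + 2) j dvd square_divisor N i * U3_divisor (i + 0) j"
  unfolding square_divisor_def odd_divisor_def U3_divisor_def
proof (rule if_power_dvd_mult)
  assume *: "j mod 4 = 3 * (i + 0) mod 4 \<and> i + 0 \<le> 3 * j \<and> j \<le> 3 * (i + 0)" "i mod 4 = 1"
  show j: "j mod 4 = 3"
  proof -
    have "3 * i mod 4 = 3" using *(2) by presburger
    thus ?thesis using * by auto
  qed
  have "3 \<le> j" using j by presburger
  have "(9 * j - 8) div 8 \<le> (9 * i - 10) div 8 + (9 * j - 3 * (i + 0) - 1) div 8"
  proof (cases "i = 1")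
    case True
    with * \<open>3 \<le> j\<close> have "j = 3" by simp
    thus ?thesis using True by simp
  next
    case False
    hence "5 \<le> i" using *(2) by presburger
    thus ?thesis using * by (intro div_8_le_add2) auto
  qed
  moreover have "(9 * j - 8) div 8 = 2 + (9 * j - 24) div 8" using \<open>3 \<le> j\<close> by auto
  ultimately show "N + 2 + (9 * j - 24) div 8 \<le> N + (9 * i - 10) div 8 + (9 * j - 3 * (i + 0) - 1) div 8"
    by simp
qed

lemma U3_mult_odd:
  "f \<in> hauptmodul_span (odd_divisor N) \<Longrightarrow> U3 (f * hauptmodul) \<in> hauptmodul_span (even_divisor N)"
  using U3_hauptmodul_span[OF _ even_divisor_dvd, of f N] by (simp del: One_nat_def)

lemma U3_mult_even:
  "f \<in> hauptmodul_span (even_divisor N) \<Longrightarrow> U3 (f * hauptmodul) \<in> hauptmodul_span (odd_divisor (N + 3))"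
  using U3_hauptmodul_span[OF _ odd_divisor_dvd_even, of f N] by (simp del: One_nat_def)

lemma U3_odd:
  "f \<in> hauptmodul_span (odd_divisor N) \<Longrightarrow> U3 f \<in> hauptmodul_span (square_divisor N)"
  using U3_hauptmodul_span[OF _ square_divisor_dvd, of f N] by simp

lemma U3_square:
  "f \<in> hauptmodul_span (square_divisor N) \<Longrightarrow> U3 f \<in> hauptmodul_span (odd_divisor (N + 2))"
  using U3_hauptmodul_span[OF _ odd_divisor_dvd_square, of f N] by simp

theorem funpow_U3_eta_fps_span:
  "(U3 ^^ (2*\<alpha>+2*\<beta>+1)) (eta_fps (2*\<alpha>+1)) \<in> hauptmodul_span (odd_divisor (3*\<alpha>+2*\<beta>+2))"
proof -
  let ?V = "\<lambda>f. U3 (f * hauptmodul)"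
  have "(?V ^^ (2*\<alpha>+1)) 1 \<in> hauptmodul_span (odd_divisor (3*\<alpha>+2))"
  proof (induction \<alpha>)
    case 0
    have "of_int 9 * hauptmodul ^ 3 \<in> hauptmodul_span (odd_divisor 2)"
      by (intro hauptmodul_span_monomial) (simp add: odd_divisor_def)
    moreover have "(?V ^^ (2 * 0 + 1)) 1 = 9 * hauptmodul ^ 3"
      using U3_hauptmodul by simp
    ultimately show ?case by (simp only: mult_0_right add_0 of_int_numeral)
  next
    case (Suc \<alpha>)
    have "3 * Suc \<alpha> + 2 = 3*\<alpha>+2+3" "2 * Suc \<alpha> + 1 = Suc (Suc (2*\<alpha>+1))" by simp_all
    thus ?case using U3_mult_even[OF U3_mult_odd[OF Suc]] by (simp only: funpow.simps o_apply)
  qed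
  moreover have "(U3 ^^ (2*\<alpha>+1)) (eta_fps (2*\<alpha>+1)) = (?V ^^ (2*\<alpha>+1)) 1"
    using funpow_U3_eta_fps[of "2*\<alpha>+1" "2*\<alpha>+1"] by (simp add: eta_fps_0 del: One_nat_def)
  ultimately have start: "(U3 ^^ (2*\<alpha>+1)) (eta_fps (2*\<alpha>+1)) \<in> hauptmodul_span (odd_divisor (3*\<alpha>+2))"
    by (simp only:)
  show ?thesis
  proof (induction \<beta>)
    case 0
    show ?case using start by simp
  next
    case (Suc \<beta>)
    have "3*\<alpha> + 2 * Suc \<beta> + 2 = 3*\<alpha>+2*\<beta>+2+2" "2*\<alpha> + 2 * Suc \<beta> + 1 = Suc (Suc (2*\<alpha>+2*\<beta>+1))" by simp_all
    thus ?case using U3_square[OF U3_odd[OF Suc]] by (simp only: funpow.simps o_apply)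
  qed
qed

section \<open>Exceptional residue classes and sums of two squares\<close>

lemma numeral_dvd_fps_iff:
  "(numeral k :: int fps) dvd f \<longleftrightarrow> (\<forall>n. numeral k dvd fps_nth f n)"
proof
  assume "numeral k dvd f"
  thus "\<forall>n. numeral k dvd fps_nth f n"
    by (auto simp: fps_numeral_fps_const)
next
  assume "\<forall>n. numeral k dvd fps_nth f n"
  hence "f = numeral k * Abs_fps (\<lambda>n. fps_nth f n div numeral k)"
    by (intro fps_ext) (simp add: fps_numeral_fps_const)
  thus "numeral k dvd f" by (rule dvdI)
qed

section \<open>The Hauptmodul modulo 3, 9 and 27\<close>

lemma dvd_mult_diff:
  fixes a b c d m :: "'a::comm_ring_1"
  assumes "m dvd a - b" "m dvd c - d"
  shows "m dvd a * c - b * d"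
proof -
  have "a * c - b * d = (a - b) * c + b * (c - d)" by (simp add: algebra_simps)
  thus ?thesis using assms by simp
qed

lemma nine_dvd_cube_diff:
  fixes x y :: "'a::comm_ring_1"
  assumes "3 dvd x - y"
  shows "9 dvd x ^ 3 - y ^ 3"
proof -
  obtain z where "x - y = 3 * z" using assms by blast
  hence "x = y + 3 * z" by (simp add: algebra_simps)
  hence "x ^ 3 - y ^ 3 = 9 * (y ^ 2 * z + 3 * y * z ^ 2 + 3 * z ^ 3)"
    by (simp add: power2_eq_square power3_eq_cube algebra_simps)
  thus ?thesis by (simp only: dvd_triv_left)
qed

text \<open>Each factor satisfies (1-y)^3 = 1 - y^3 modulo 3, and each coefficient depends on
  finitely many factors.\<close>

lemma three_dvd_euler_fps_cube: "3 dvd euler_fps 1 ^ 3 - (euler_fps 3 :: int fps)"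
proof -
  have part: "3 dvd euler_part 1 n ^ 3 - (euler_part 3 n :: int fps)" for n
  proof (induction n)
    case (Suc n)
    define y :: "int fps" where "y = fps_X ^ Suc n"
    have "fps_X ^ (3 * Suc n) = y ^ 3" unfolding y_def by (simp only: power_mult [symmetric] mult.commute)
    moreover have "(1 - y) ^ 3 - (1 - y ^ 3) = 3 * (y * y - y)"
      by (simp add: power3_eq_cube algebra_simps)
    ultimately have "3 dvd (1 - fps_X ^ (1 * Suc n)) ^ 3 - (1 - fps_X ^ (3 * Suc n) :: int fps)"
      by (simp only: mult_1 y_def [symmetric] dvd_triv_left)
    thus ?case unfolding euler_part_Suc power_mult_distrib by (rule dvd_mult_diff[OF Suc.IH])
  qed simp
  show ?thesis unfolding numeral_dvd_fps_iff
  proof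
    fix n
    have "fps_eq_upto n (euler_part 1 (Suc n) ^ 3) (euler_fps 1 ^ 3 :: int fps)"
      by (intro fps_eq_upto_power euler_part_upto) auto
    moreover have "fps_eq_upto n (euler_part 3 (Suc n)) (euler_fps 3 :: int fps)"
      by (intro euler_part_upto) auto
    ultimately have "fps_nth (euler_fps 1 ^ 3 - (euler_fps 3 :: int fps)) n
        = fps_nth (euler_part 1 (Suc n) ^ 3 - euler_part 3 (Suc n)) n"
      by (simp add: fps_eq_upto_def)
    thus "3 dvd fps_nth (euler_fps 1 ^ 3 - (euler_fps 3 :: int fps)) n"
      using part[of "Suc n"] unfolding numeral_dvd_fps_iff by metis
  qed
qed

text \<open>Cubing the congruence modulo 3 gives E(q)^9 = E(q^3)^3 modulo 9; dividing by the unit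
  E(q)^3 leaves E(q)^6, the square of Jacobi's series.\<close>

lemma nine_dvd_T_fps_3_diff: "9 dvd T_fps 3 - jacobi_fps ^ 2"
proof -
  let ?E = "euler_fps 1 ^ 3 :: int fps"
  define r where "r = fps_right_inverse ?E 1"
  have r: "?E * r = 1" unfolding r_def by (rule fps_right_inverse) (simp add: fps_nth_power_0)
  have "T_fps 3 * ?E - ?E ^ 3 = -(?E ^ 3 - euler_fps 3 ^ 3)"
    by (simp add: T_fps_mult del: One_nat_def)
  hence "9 dvd T_fps 3 * ?E - ?E ^ 3"
    using nine_dvd_cube_diff[OF three_dvd_euler_fps_cube] by (simp only: dvd_minus_iff)
  hence "9 dvd (T_fps 3 * ?E - ?E ^ 3) * r" by (rule dvd_mult2)
  moreover have "(T_fps 3 * ?E - ?E ^ 3) * r = (T_fps 3 - ?E ^ 2) * (?E * r)"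
    by (simp add: power2_eq_square power3_eq_cube algebra_simps)
  ultimately have "9 dvd (T_fps 3 - ?E ^ 2) * (?E * r)" by (simp only:)
  thus ?thesis unfolding r unfolding euler_fps_cube mult_1_right .
qed

text \<open>A nonzero coefficient of the squared Jacobi series needs \<open>n\<close> to be a sum of
  two triangular numbers, which makes \<open>8 * n + 2\<close> a sum of two odd squares.\<close>

lemma nine_dvd_T_3:
  assumes "\<And>i j. (2*i+1) ^ 2 + (2*j+1) ^ 2 \<noteq> 8 * n + 2"
  shows "9 dvd fps_nth (T_fps 3) n"
proof -
  have "fps_nth (jacobi_fps ^ 2 :: int fps) n = 0"
    unfolding power2_eq_square fps_mult_nth
  proof (rule sum.neutral, rule ballI)
    fix k assume k: "k \<in> {0..n}"
    show "fps_nth jacobi_fps k * fps_nth jacobi_fps (n - k) = (0::int)"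
    proof (rule ccontr)
      assume "fps_nth jacobi_fps k * fps_nth jacobi_fps (n - k) \<noteq> (0::int)"
      hence "k \<in> range triangular" "n - k \<in> range triangular"
        using jacobi_fps_nth_eq_0 by (metis mult_zero_left, metis mult_zero_right)
      then obtain i j where "k = triangular i" "n - k = triangular j" by blast
      hence "n = triangular i + triangular j" using k by simp
      hence "(2*i+1) ^ 2 + (2*j+1) ^ 2 = 8 * n + 2"
        unfolding eight_triangular [symmetric] by simp
      thus False using assms by blast
    qed
  qed
  thus ?thesis using nine_dvd_T_fps_3_diff unfolding numeral_dvd_fps_iff
    by (metis diff_zero fps_sub_nth)
qed

text \<open>Modulo 3 the series E(q)^6 equals E(q^3)^2, a series in q^3.\<close>

lemma three_dvd_T_3:
  assumes "n mod 3 \<noteq> 0"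
  shows "3 dvd fps_nth (T_fps 3) n"
proof -
  have "3 dvd euler_fps 1 ^ 3 * euler_fps 1 ^ 3 - (euler_fps 3 * euler_fps 3 :: int fps)"
    by (intro dvd_mult_diff three_dvd_euler_fps_cube)
  moreover have "3 dvd T_fps 3 - euler_fps 1 ^ 3 * euler_fps 1 ^ 3"
  proof -
    have "(3 :: int fps) dvd 9" by (rule dvdI[of _ _ 3]) simp
    thus ?thesis using nine_dvd_T_fps_3_diff unfolding euler_fps_cube power2_eq_square
      by (rule dvd_trans)
  qed
  ultimately have "3 dvd (T_fps 3 - euler_fps 1 ^ 3 * euler_fps 1 ^ 3)
      + (euler_fps 1 ^ 3 * euler_fps 1 ^ 3 - (euler_fps 3 * euler_fps 3))"
    by (intro dvd_add)
  hence "3 dvd T_fps 3 - euler_fps 3 * euler_fps 3" by simp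
  moreover have "euler_fps 3 * euler_fps 3 = (euler_fps 1 * euler_fps 1) oo (fps_X ^ 3 :: int fps)"
    by (simp add: fps_compose_mult_distrib euler_fps_compose_X_power del: One_nat_def)
  hence "fps_nth (euler_fps 3 * euler_fps 3 :: int fps) n = 0"
    using assms by (simp only: fps_nth_compose_X_power) (simp add: dvd_eq_mod_eq_0)
  ultimately show ?thesis unfolding numeral_dvd_fps_iff by (metis diff_zero fps_sub_nth)
qed

lemma three_dvd_hauptmodul:
  assumes "n mod 3 = 2"
  shows "3 dvd fps_nth hauptmodul n"
proof (cases "n mod 4 = 1")
  case True
  define m where "m = n div 4"
  have n: "n = 4 * m + 1" using True unfolding m_def by presburger
  \<comment> \<open>\<open>m\<close> divisible by 3 would give \<open>n mod 3 = 1\<close>.\<close>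
  have "m mod 3 \<noteq> 0" using assms n by presburger
  thus ?thesis unfolding n hauptmodul_nth by (rule three_dvd_T_3)
qed (simp add: hauptmodul_nth_eq_0 del: One_nat_def)

text \<open>Write a for the Hauptmodul. As b lives on exponents divisible by 3, elsewhere a^3 is
  9ab^2 modulo 27. Since b^2 is a series in x^3, a coefficient of ab^2 in class 2 involves only
  coefficients of a in class 2, all divisible by 3.\<close>

lemma hauptmodul_cube_dvd:
  shows "n mod 3 \<noteq> 0 \<Longrightarrow> 9 dvd fps_nth (hauptmodul ^ 3) n"
    and "n mod 3 = 2 \<Longrightarrow> 27 dvd fps_nth (hauptmodul ^ 3) n"
proof -
  define b where "b = hauptmodul oo fps_X ^ 3"
  have eq: "fps_nth (hauptmodul ^ 3) n = 9 * fps_nth (hauptmodul * b ^ 2) n + 27 * fps_nth (hauptmodul ^ 2 * b ^ 3) n"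
    if "n mod 3 \<noteq> 0"
  proof -
    have "fps_nth b n = 0" using that by (simp add: b_def fps_nth_compose_X_power dvd_eq_mod_eq_0)
    moreover have "hauptmodul ^ 3 = b + fps_const 9 * (hauptmodul * b ^ 2) + fps_const 27 * (hauptmodul ^ 2 * b ^ 3)"
      unfolding hauptmodul_cubic b_def by (simp add: fps_numeral_fps_const [symmetric] mult_ac)
    ultimately show ?thesis by simp
  qed
  thus "n mod 3 \<noteq> 0 \<Longrightarrow> 9 dvd fps_nth (hauptmodul ^ 3) n" by simp
  assume n: "n mod 3 = 2"
  have "3 dvd fps_nth (hauptmodul * b ^ 2) n"
    unfolding fps_mult_nth
  proof (rule dvd_sum)
    fix i assume i: "i \<in> {0..n}"
    show "3 dvd fps_nth hauptmodul i * fps_nth (b ^ 2) (n - i)"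
    proof (cases "i mod 3 = 2")
      case True
      thus ?thesis by (intro dvd_mult2 three_dvd_hauptmodul)
    next
      case False
      have "\<not> 3 dvd n - i" using False n i by (auto, presburger)
      moreover have "b ^ 2 = (hauptmodul ^ 2) oo fps_X ^ 3" by (simp add: b_def fps_compose_power)
      ultimately show ?thesis by (simp add: fps_nth_compose_X_power)
    qed
  qed
  then obtain c where "fps_nth (hauptmodul * b ^ 2) n = 3 * c" by blast
  thus "27 dvd fps_nth (hauptmodul ^ 3) n" using eq n by simp
qed

text \<open>Otherwise x^2 = -y^2 modulo p with both units; raising to the odd power (p-1)/2 gives 1
  = -1 by Fermat.\<close>

lemma prime_3_mod_4_dvd_sum_squares:
  fixes p x y :: nat
  assumes "prime p" "p mod 4 = 3" "p dvd x ^ 2 + y ^ 2"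
  shows "p dvd x"
proof (rule ccontr)
  assume x: "\<not> p dvd x"
  have y: "\<not> p dvd y"
  proof
    assume "p dvd y"
    hence "p dvd x ^ 2" using assms(3) by (simp add: dvd_add_left_iff power2_eq_square)
    thus False using x assms(1) prime_dvd_power by blast
  qed
  define h where "h = (p - 1) div 2"
  have p1: "p - 1 = 2 * h" and "odd h" using assms(2) unfolding h_def by presburger+
  have fermat: "[int z ^ (p - 1) = 1] (mod int p)" if "\<not> p dvd z" for z
  proof -
    have "[z ^ (p - 1) = 1] (mod p)" using fermat_theorem[OF assms(1) that] .
    thus ?thesis by (metis cong_int_iff of_nat_1 of_nat_power)
  qed
  have "[int x ^ 2 = - (int y ^ 2)] (mod int p)"
    using assms(3) unfolding cong_iff_dvd_diff
    by (metis diff_minus_eq_add int_dvd_int_iff of_nat_add of_nat_power)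
  hence "[(int x ^ 2) ^ h = (- (int y ^ 2)) ^ h] (mod int p)" by (rule cong_pow)
  also have "(- (int y ^ 2)) ^ h = - ((int y ^ 2) ^ h)" using \<open>odd h\<close> by (simp add: power_minus_odd)
  finally have "[int x ^ (p - 1) = - (int y ^ (p - 1))] (mod int p)"
    unfolding p1 by (simp only: power_mult)
  hence "[1 = - (1::int)] (mod int p)"
    using fermat[OF x] fermat[OF y] by (metis cong_minus_minus_iff cong_sym cong_trans)
  hence "int p dvd 2" by (simp add: cong_iff_dvd_diff)
  hence "p dvd 2" using int_dvd_int_iff[of p 2] by simp
  hence "p \<le> 2" by (rule dvd_imp_le) simp
  thus False using assms(2) by (cases "p = 0"; cases "p = 1"; cases "p = 2") auto
qed

text \<open>Descent: p divides both x and y, so p^2 can be removed until a single p is left, which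
  would force p to divide u.\<close>

lemma sum_squares_neq_odd_prime_power:
  fixes p x y u :: nat
  assumes "prime p" "p mod 4 = 3" "\<not> p dvd u"
  shows "x ^ 2 + y ^ 2 \<noteq> p ^ (2*k+1) * u"
proof -
  have p0: "p > 0" using assms(1) prime_gt_0_nat by blast
  have descend: "\<exists>x' y'. x = p * x' \<and> y = p * y'" if "p dvd x ^ 2 + y ^ 2" for x y
    using prime_3_mod_4_dvd_sum_squares[OF assms(1,2), of x y] prime_3_mod_4_dvd_sum_squares[OF assms(1,2), of y x] that
    by (simp add: add.commute) blast
  show ?thesis
  proof (induction k arbitrary: x y)
    case 0
    show ?case
    proof
      assume eq: "x ^ 2 + y ^ 2 = p ^ (2*0+1) * u"
      hence "p dvd x ^ 2 + y ^ 2" by simp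
      then obtain x' y' where "x = p * x'" "y = p * y'" using descend by blast
      hence "p * (p * (x' ^ 2 + y' ^ 2)) = p * u" using eq by (simp add: power2_eq_square algebra_simps)
      hence "p * (x' ^ 2 + y' ^ 2) = u" using p0 by simp
      thus False using assms(3) by auto
    qed
  next
    case (Suc k)
    show ?case
    proof
      assume eq: "x ^ 2 + y ^ 2 = p ^ (2 * Suc k + 1) * u"
      hence "p dvd x ^ 2 + y ^ 2" by simp
      then obtain x' y' where "x = p * x'" "y = p * y'" using descend by blast
      hence "p ^ 2 * (x' ^ 2 + y' ^ 2) = p ^ 2 * (p ^ (2*k+1) * u)"
        using eq by (simp add: power2_eq_square algebra_simps)
      hence "x' ^ 2 + y' ^ 2 = p ^ (2*k+1) * u" using p0 by simp
      thus False using Suc.IH by blast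
    qed
  qed
qed

section \<open>Reading off the coefficients\<close>

lemma T_eq_eta_fps_nth:
  assumes "8 * n + 3 ^ m = 2 * k + 1"
  shows "int (T (3 ^ m) n) = fps_nth (eta_fps m) k"
proof -
  have "odd ((3::nat) ^ m)" by simp
  then obtain c where c: "(3::nat) ^ m = 2 * c + 1" by (elim oddE)
  have k: "k = 4 * n + (3 ^ m - 1) div 2" using assms c by simp
  show ?thesis unfolding k eta_fps_def
    by (simp add: fps_X_power_mult_nth fps_nth_compose_X_power T_fps_def)
qed

lemma T_eq_funpow_U3_nth:
  assumes "8 * n + 3 ^ m = 2 * (3 ^ s * k) + 1"
  shows "int (T (3 ^ m) n) = fps_nth ((U3 ^^ s) (eta_fps m)) k"
  unfolding funpow_U3_nth by (rule T_eq_eta_fps_nth[OF assms])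

text \<open>All degrees above 3 carry at least 3^(N+4), so only the coefficient of the cube of the
  Hauptmodul matters.\<close>

lemma odd_span_dvd_nth:
  assumes "f \<in> hauptmodul_span (odd_divisor N)"
  shows "3 ^ N dvd fps_nth f n"
    and "n mod 3 \<noteq> 0 \<Longrightarrow> 3 ^ (N + 2) dvd fps_nth f n"
    and "n mod 3 = 2 \<Longrightarrow> 3 ^ (N + 3) dvd fps_nth f n"
proof -
  have high: "3 ^ (N + 4) dvd odd_divisor N i" if "i \<noteq> 3" for i
  proof (cases "i mod 4 = 3")
    case True
    hence "7 \<le> i" using that by presburger
    thus ?thesis using True by (simp add: odd_divisor_def le_imp_power_dvd)
  qed (simp add: odd_divisor_def)
  have *: "3 ^ (N + e) dvd fps_nth f n" if "3 ^ e dvd fps_nth (hauptmodul ^ 3) n" "e \<le> 4" for e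
  proof (rule hauptmodul_span_dvd_nth[OF assms])
    fix i
    show "3 ^ (N + e) dvd odd_divisor N i * fps_nth (hauptmodul ^ i) n"
    proof (cases "i = 3")
      case True
      thus ?thesis using that(1) by (simp add: odd_divisor_def power_add mult_dvd_mono)
    next
      case False
      have "(3::int) ^ (N + e) dvd 3 ^ (N + 4)" using that(2) by (intro le_imp_power_dvd) simp
      thus ?thesis using high[OF False] by (metis dvd_mult2 dvd_trans)
    qed
  qed
  show "3 ^ N dvd fps_nth f n" using *[of 0] by simp
  show "n mod 3 \<noteq> 0 \<Longrightarrow> 3 ^ (N + 2) dvd fps_nth f n" using *[of 2] hauptmodul_cube_dvd(1)[of n] by simp
  show "n mod 3 = 2 \<Longrightarrow> 3 ^ (N + 3) dvd fps_nth f n" using *[of 3] hauptmodul_cube_dvd(2)[of n] by simp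
qed

text \<open>From degree 5 on the weight alone suffices; the linear term has weight 3^N and takes the
  remaining 9 from the second hypothesis.\<close>

lemma square_span_dvd_nth:
  assumes "f \<in> hauptmodul_span (square_divisor N)" "9 dvd fps_nth hauptmodul n"
  shows "3 ^ (N + 2) dvd fps_nth f n"
proof (rule hauptmodul_span_dvd_nth[OF assms(1)])
  fix i
  show "3 ^ (N + 2) dvd square_divisor N i * fps_nth (hauptmodul ^ i) n"
  proof (cases "i = 1")
    case True
    thus ?thesis using assms(2) by (simp add: square_divisor_def power_add mult_dvd_mono del: One_nat_def)
  next
    case False
    have "3 ^ (N + 2) dvd square_divisor N i"
    proof (cases "i mod 4 = 1")
      case True
      hence "5 \<le> i" using False by presburger
      hence "2 \<le> (9 * i - 10) div 8" by simp
      thus ?thesis unfolding square_divisor_def if_P[OF True] by (intro le_imp_power_dvd) simp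
    qed (simp add: square_divisor_def)
    thus ?thesis by (rule dvd_mult2)
  qed
qed

lemma cong_0_if_power_dvd: "3 ^ e dvd int a \<Longrightarrow> [a = 0] (mod 3 ^ e)"
  by (metis cong_0_iff int_dvd_int_iff of_nat_numeral of_nat_power)

theorem theorem1p1:
  fixes \<alpha> \<beta> k :: nat
  shows "(\<forall>n::nat. [T (3 ^ (2*\<alpha>+1))
            (3 ^ (2*\<alpha>+2*\<beta>+1) * n + (2 * 3 ^ (2*\<alpha>+2*\<beta>+2) - 3 ^ (2*\<alpha>+1) + 1) div 8) = 0]
            (mod 3 ^ (3*\<alpha>+2*\<beta>+2)))
    \<and> (\<forall>n::nat. [T (3 ^ (2*\<alpha>+1))
            (3 ^ (2*\<alpha>+2*\<beta>+2) * n + (14 * 3 ^ (2*\<alpha>+2*\<beta>+1) - 3 ^ (2*\<alpha>+1) + 1) div 8) = 0]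
            (mod 3 ^ (3*\<alpha>+2*\<beta>+4)))
    \<and> (\<forall>n::nat. [T (3 ^ (2*\<alpha>+1))
            (3 ^ (2*\<alpha>+2*\<beta>+2) * n + (22 * 3 ^ (2*\<alpha>+2*\<beta>+1) - 3 ^ (2*\<alpha>+1) + 1) div 8) = 0]
            (mod 3 ^ (3*\<alpha>+2*\<beta>+5)))
    \<and> (\<forall>p::nat. prime p \<and> [p = 3] (mod 4) \<longrightarrow> (\<forall>n::nat. \<not> p dvd n \<longrightarrow>
          [T (3 ^ (2*\<alpha>+1))
            (3 ^ (2*\<alpha>+2*\<beta>+2) * p ^ (2*k+1) * n
               + (2 * p ^ (2*k+2) * 3 ^ (2*\<alpha>+2*\<beta>+2) - 3 ^ (2*\<alpha>+1) + 1) div 8) = 0]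
            (mod 3 ^ (3*\<alpha>+2*\<beta>+4))))"
proof -
  define s N l where "s = 2*\<alpha>+2*\<beta>+1" and "N = 3*\<alpha>+2*\<beta>+2" and "l = 2*\<alpha>+1"
  define F where "F = (U3 ^^ s) (eta_fps l)"
  have e: "2*\<alpha>+2*\<beta>+2 = Suc s" "3*\<alpha>+2*\<beta>+4 = N + 2" "3*\<alpha>+2*\<beta>+5 = N + 3"
    by (simp_all add: s_def N_def)
  have F: "F \<in> hauptmodul_span (odd_divisor N)"
    unfolding F_def s_def N_def l_def by (rule funpow_U3_eta_fps_span)
  have off: "8 * x + 3 ^ l = c + 1" if "real x = (real c - 3 ^ l + 1) / 8" for x c :: nat
  proof -
    have "real (8 * x + 3 ^ l) = real (c + 1)" using that by simp
    thus ?thesis by (simp only: of_nat_eq_iff)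
  qed
  note o = offsets_exact[where \<alpha> = \<alpha> and \<beta> = \<beta>, folded s_def l_def, unfolded e]
  have A: "[T (3 ^ l) (3 ^ s * n + (2 * 3 ^ Suc s - 3 ^ l + 1) div 8) = 0] (mod 3 ^ N)" for n
  proof -
    have "8 * ((2 * (3::nat) ^ Suc s - 3 ^ l + 1) div 8) + 3 ^ l = 2 * 3 ^ Suc s + 1"
      by (rule off) (simp only: o(1), simp)
    \<comment> \<open>The progression is exactly what s applications of \<open>U3\<close> pick out:
      here the coefficients at \<open>4*n+3\<close>.\<close>
    hence "8 * (3 ^ s * n + (2 * 3 ^ Suc s - 3 ^ l + 1) div 8) + 3 ^ l = 2 * (3 ^ s * (4*n+3)) + 1"
      by (simp add: algebra_simps)
    thus ?thesis using odd_span_dvd_nth(1)[OF F, of "4*n+3"] unfolding F_def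
      by (intro cong_0_if_power_dvd) (simp only: T_eq_funpow_U3_nth)
  qed
  have B: "[T (3 ^ l) (3 ^ Suc s * n + (14 * 3 ^ s - 3 ^ l + 1) div 8) = 0] (mod 3 ^ (N + 2))" for n
  proof -
    have "8 * ((14 * (3::nat) ^ s - 3 ^ l + 1) div 8) + 3 ^ l = 14 * 3 ^ s + 1"
      by (rule off) (simp only: o(2), simp)
    \<comment> \<open>This refines the previous progression to the indices in class 1 modulo
      3.\<close>
    hence "8 * (3 ^ Suc s * n + (14 * 3 ^ s - 3 ^ l + 1) div 8) + 3 ^ l = 2 * (3 ^ s * (12*n+7)) + 1"
      by (simp add: algebra_simps)
    moreover have "(12*n+7) mod 3 \<noteq> 0" by presburger
    ultimately show ?thesis using odd_span_dvd_nth(2)[OF F, of "12*n+7"] unfolding F_def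
      by (intro cong_0_if_power_dvd) (simp only: T_eq_funpow_U3_nth not_False_eq_True simp_thms)
  qed
  have C: "[T (3 ^ l) (3 ^ Suc s * n + (22 * 3 ^ s - 3 ^ l + 1) div 8) = 0] (mod 3 ^ (N + 3))" for n
  proof -
    have "8 * ((22 * (3::nat) ^ s - 3 ^ l + 1) div 8) + 3 ^ l = 22 * 3 ^ s + 1"
      by (rule off) (simp only: o(3), simp)
    \<comment> \<open>The indices in class 2 modulo 3.\<close>
    hence "8 * (3 ^ Suc s * n + (22 * 3 ^ s - 3 ^ l + 1) div 8) + 3 ^ l = 2 * (3 ^ s * (12*n+11)) + 1"
      by (simp add: algebra_simps)
    moreover have "(12*n+11) mod 3 = 2" by presburger
    ultimately show ?thesis using odd_span_dvd_nth(3)[OF F, of "12*n+11"] unfolding F_def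
      by (intro cong_0_if_power_dvd) (simp only: T_eq_funpow_U3_nth)
  qed
  have D: "[T (3 ^ l) (3 ^ Suc s * p ^ (2*k+1) * n + (2 * p ^ (2*k+2) * 3 ^ Suc s - 3 ^ l + 1) div 8) = 0]
      (mod 3 ^ (N + 2))" if p: "prime p" "p mod 4 = 3" and n: "\<not> p dvd n" for p n :: nat
  proof -
    have "odd p" using p(2) by presburger
    have "8 * ((2 * p ^ (2*k+2) * 3 ^ Suc s - 3 ^ l + 1) div 8) + 3 ^ l = 2 * p ^ (2*k+2) * 3 ^ Suc s + 1"
      by (rule off) (simp only: o(4)[OF \<open>odd p\<close>], simp)
    \<comment> \<open>One further \<open>U3\<close> is applied, so the square weights and the linear
      term decide.\<close>
    hence idx: "8 * (3 ^ Suc s * p ^ (2*k+1) * n + (2 * p ^ (2*k+2) * 3 ^ Suc s - 3 ^ l + 1) div 8) + 3 ^ l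
        = 2 * (3 ^ Suc s * (p ^ (2*k+1) * (4*n+p))) + 1"
      by (simp add: algebra_simps)
    \<comment> \<open>Both factors are 3 modulo 4, so the index has the form 4m+1, where
      \<open>hauptmodul_nth\<close> applies.\<close>
    have "(p ^ (2*k+1) * (4*n+p)) mod 4 = 1"
    proof -
      have "[p ^ (2*k+1) * (4*n+p) = 3 ^ (2*k+1) * (4*n+3)] (mod 4)"
        using p(2) by (intro cong_mult cong_pow cong_add) (simp_all add: cong_def)
      also have "[3 ^ (2*k+1) * (4*n+3) = 9 ^ k * 9] (mod (4::nat))"
      proof -
        have "3 ^ (2*k+1) = 3 * (9::nat) ^ k" by (simp add: power_mult)
        hence "3 ^ (2*k+1) * (4*n+3) = 9 ^ k * 9 + 4 * (9 ^ k * (3 * n))"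
          by (simp only:) (simp add: algebra_simps)
        thus ?thesis by (simp only: cong_def mod_mult_self2)
      qed
      also have "[9 ^ k * 9 = 1 ^ k * 1] (mod (4::nat))"
        by (intro cong_mult cong_pow) (simp_all add: cong_def)
      finally show ?thesis by (simp add: cong_def)
    qed
    then obtain m where m: "p ^ (2*k+1) * (4*n+p) = 4 * m + 1" by (metis mult_div_mod_eq)
    have "\<not> p dvd 2 * (4*n+p)"
    proof
      assume "p dvd 2 * (4*n+p)"
      hence "p dvd 8 * n + p * 2" by (simp add: algebra_simps)
      hence "p dvd 2 ^ 3 * n" by (simp add: dvd_add_left_iff)
      hence "p dvd 2 ^ 3" using n p(1) prime_dvd_mult_iff by blast
      hence "p dvd 2" using p(1) prime_dvd_power by blast
      thus False using \<open>odd p\<close> by (metis dvd_refl p(1) primes_dvd_imp_eq two_is_prime_nat)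
    qed
    have "(2*i+1) ^ 2 + (2*j+1) ^ 2 \<noteq> 8 * m + 2" for i j
    proof -
      \<comment> \<open>Thus 8m+2 contains p to an odd power exactly and cannot be a sum of two
        squares.\<close>
      have "p ^ (2*k+1) * (2 * (4*n+p)) = 2 * (p ^ (2*k+1) * (4*n+p))" by (simp only: mult_ac)
      also have "\<dots> = 8 * m + 2" unfolding m by simp
      finally show ?thesis
        using sum_squares_neq_odd_prime_power[OF p \<open>\<not> p dvd 2 * (4*n+p)\<close>, of "2*i+1" "2*j+1" k] by simp
    qed
    hence "9 dvd fps_nth hauptmodul (p ^ (2*k+1) * (4*n+p))"
      unfolding m hauptmodul_nth by (rule nine_dvd_T_3)
    with U3_odd[OF F] have "3 ^ (N + 2) dvd fps_nth (U3 F) (p ^ (2*k+1) * (4*n+p))"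
      by (rule square_span_dvd_nth)
    moreover have "U3 F = (U3 ^^ Suc s) (eta_fps l)" by (simp add: F_def)
    ultimately show ?thesis using idx
      by (intro cong_0_if_power_dvd) (simp only: T_eq_funpow_U3_nth)
  qed
  show ?thesis
    unfolding e s_def [symmetric] N_def [symmetric] l_def [symmetric]
    using A B C D by (auto simp only: cong_def) (simp_all add: cong_def)
qed

end
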